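(* Suppose that $f:X\to X$ is a positively continuum-wise expansive homeomorphism on a continuum $X$ with metric $d$ such that $X$ has a periodic $u$-chaotic continuum $H$ of $f$ which is indecomposable and such that the set of composants of $H$ coincides with $\{V^u(x;H)\mid x\in H\}$. Then there exists a Cantor set $Z$ in $H$ which is vertically embedded to composants of $H$ and satisfies the conditions: (1) if $x,y$ belong to the same composant of $H$, then $\lim_{n\to\infty}d(f^{-n}(x),f^{-n}(y))=0$; (2) every finite tuple of points of $Z$ is an IE-tuple of $f^{-1}$; (3) for all $k\in\mathbb N$, any $k$ distinct points $y_1,\dots,y_k\in Z$ and any points $z_1,\dots,z_k\in Z$, $$\liminf_{n\to\infty}\max\{d(f^{-n}(y_i),z_i)\mid 1\le i\le k\}=0.$$
   Context: All maps are continuous; $\mathbb N=\{1,2,\dots\}$. A continuum is a compact connected metric space; it is nondegenerate if it has more than one point, and indecomposable if it is nondegenerate and not the union of two proper subcontinua. A homeomorphism $f:X\to X$ of a compact metric space is positively continuum-wise expansive if there is $c>0$ such that for every nondegenerate subcontinuum $A$ of $X$ there is $n\in\mathbb N$ with $\operatorname{diam} f^n(A)>c$. For an indecomposable continuum $H$, the composant of $p\in H$ is the set of all points of $H$ that can be joined with $p$ by a proper subcontinuum of $H$. A subset $Z$ of $H$ is vertically embedded to composants of $H$ if no two distinct points of $Z$ belong to the same composant of $H$. For a closed set $H\subset X$ let $C(H)$ be the set of nonempty closed connected subsets of $H$, and for $x\in H$ put $V^u(x;H)=\{y\in H\mid \exists A\in C(H): x,y\in A,\ \lim_{n\to\infty}\operatorname{diam}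 f^{-n}(A)=0\}$. A subcontinuum $H$ of $X$ is a $u$-chaotic continuum of $f$ if (i) for each $x\in H$, $V^u(x;H)$ is dense in $H$, and (ii) there is $\tau>0$ such that for each $x\in H$ and each neighborhood $U$ of $x$ in $X$ there is $y\in U\cap H$ with $\liminf_{n\to\infty}d(f^{-n}(x),f^{-n}(y))\ge\tau$. $H$ is periodic if $f^n(H)=H$ for some $n\in\mathbb N$. Let $g:X\to X$ be a map. A set $I\subseteq\mathbb N$ has positive density if $\liminf_{n\to\infty}|I\cap\{1,\dots,n\}|/n>0$. A collection $\mathcal A$ of subsets of $X$ has an independence set with positive density (for $g$) if there is $I\subset\mathbb N$ with positive density such that for all finite $J\subseteq I$ and all $(Y_j)\in\prod_{j\in J}\mathcal A$ we have $\bigcap_{j\in J}g^{-j}(Y_j)\neq\emptyset$. A tuple $(x_1,\dots,x_n)$ of points of $X$ is an IE-tuple of $g$ if for all open sets $A_1,\dots,A_n$ containing $x_1,\dots,x_n$ respectively, the collection $\{A_1,\dots,A_n\}$ has an independence set with positive density. *)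

theory Defs
  imports "HOL-Analysis.Analysis"
begin

text \<open>
  A homeomorphism of a set \<open>X\<close> is a map \<open>f\<close> on the ambient type with
  \<open>homeomorphism X X f g\<close>. The map \<open>g\<close> is its inverse on \<open>X\<close>, and \<open>f\<^sup>-\<^sup>n\<close> is rendered as \<open>g ^^ n\<close>.
  Topological notions for subsets of \<open>X\<close> are relative to the subspace topology \<open>top_of_set X\<close>.
\<close>

definition continuum :: "'a::metric_space set \<Rightarrow> bool" where
  "continuum X \<longleftrightarrow> compact X \<and> connected X \<and> X \<noteq> {}"

definition nondegenerate :: "'a set \<Rightarrow> bool" where
  "nondegenerate A \<longleftrightarrow> (\<exists>x\<in>A. \<exists>y\<in>A. x \<noteq> y)"

definition indecomposable_continuum :: "'a::metric_space set \<Rightarrow> bool" where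
  "indecomposable_continuum H \<longleftrightarrow>
     continuum H \<and> nondegenerate H \<and>
     \<not> (\<exists>A B. continuum A \<and> continuum B \<and> A \<subset> H \<and> B \<subset> H \<and> H = A \<union> B)"

definition pos_cw_expansive :: "'a::metric_space set \<Rightarrow> ('a \<Rightarrow> 'a) \<Rightarrow> bool" where
  "pos_cw_expansive X f \<longleftrightarrow>
     (\<exists>c>0. \<forall>A. A \<subseteq> X \<and> continuum A \<and> nondegenerate A \<longrightarrow>
        (\<exists>n\<ge>1. diameter ((f ^^ n) ` A) > c))"

definition composant :: "'a::metric_space set \<Rightarrow> 'a \<Rightarrow> 'a set" where
  "composant H p = {q \<in> H. \<exists>A. continuum A \<and> A \<subset> H \<and> p \<in> A \<and> q \<in> A}"

definition vertically_embedded :: "'a::metric_space set \<Rightarrow> 'a set \<Rightarrow> bool" where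
  "vertically_embedded Z H \<longleftrightarrow>
     Z \<subseteq> H \<and>
     (\<forall>x\<in>Z. \<forall>y\<in>Z. x \<noteq> y \<longrightarrow>
        \<not> (\<exists>p\<in>H. x \<in> composant H p \<and> y \<in> composant H p))"

definition hyperspace_C :: "'a::metric_space set \<Rightarrow> 'a set set" where
  "hyperspace_C H = {A. closedin (top_of_set H) A \<and> connected A \<and> A \<noteq> {}}"

text \<open>In the next two definitions \<open>g\<close> is the inverse of the homeomorphism under consideration.\<close>

definition Vu :: "('a::metric_space \<Rightarrow> 'a) \<Rightarrow> 'a set \<Rightarrow> 'a \<Rightarrow> 'a set" where
  "Vu g H x =
     {y \<in> H. \<exists>A\<in>hyperspace_C H. x \<in> A \<and> y \<in> A \<and>
        (\<lambda>n. diameter ((g ^^ n) ` A)) \<longlonglongrightarrow> 0}"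

definition u_chaotic_continuum ::
    "'a::metric_space set \<Rightarrow> ('a \<Rightarrow> 'a) \<Rightarrow> 'a set \<Rightarrow> bool" where
  "u_chaotic_continuum X g H \<longleftrightarrow>
     continuum H \<and> H \<subseteq> X \<and>
     (\<forall>x\<in>H. H \<subseteq> closure (Vu g H x)) \<and>
     (\<exists>\<tau>>0. \<forall>x\<in>H. \<forall>U. openin (top_of_set X) U \<and> x \<in> U \<longrightarrow>
        (\<exists>y\<in>U \<inter> H. liminf (\<lambda>n. ereal (dist ((g ^^ n) x) ((g ^^ n) y))) \<ge> ereal \<tau>))"

definition positive_density :: "nat set \<Rightarrow> bool" where
  "positive_density I \<longleftrightarrow> liminf (\<lambda>n. ereal (real (card (I \<inter> {1..n})) / real n)) > 0"

text \<open>
  The preimages are taken inside \<open>X\<close>, so that for \<open>J = {}\<close> the intersection is \<open>X\<close>.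
\<close>

definition has_independence_set_pos_density ::
    "'a set \<Rightarrow> ('a \<Rightarrow> 'a) \<Rightarrow> 'a set set \<Rightarrow> bool" where
  "has_independence_set_pos_density X g \<A> \<longleftrightarrow>
     (\<exists>I. I \<subseteq> {1..} \<and> positive_density I \<and>
        (\<forall>J Y. finite J \<and> J \<subseteq> I \<and> (\<forall>j\<in>J. Y j \<in> \<A>) \<longrightarrow>
           X \<inter> (\<Inter>j\<in>J. (g ^^ j) -` Y j) \<noteq> {}))"

definition IE_tuple :: "'a::metric_space set \<Rightarrow> ('a \<Rightarrow> 'a) \<Rightarrow> 'a list \<Rightarrow> bool" where
  "IE_tuple X g xs \<longleftrightarrow>
     xs \<noteq> [] \<and> set xs \<subseteq> X \<and>
     (\<forall>As. length As = length xs \<and>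
        (\<forall>i<length xs. openin (top_of_set X) (As ! i) \<and> xs ! i \<in> As ! i) \<longrightarrow>
        has_independence_set_pos_density X g (set As))"

text \<open>
  The model of the Cantor set is \<open>{0,1}\<^sup>\<nat>\<close>: functions \<open>nat \<Rightarrow> bool\<close> with the product topology,
  where the order topology on \<open>bool\<close> is discrete.
\<close>

definition Cantor_set :: "'a::topological_space set \<Rightarrow> bool" where
  "Cantor_set Z \<longleftrightarrow> Z homeomorphic (UNIV :: (nat \<Rightarrow> bool) set)"

end

theory Submission
  imports Defs
begin

text \<open>
  Call a continuum \<open>B\<close> shrinking if \<open>diam f\<^sup>-\<^sup>n(B) \<rightarrow> 0\<close>. Expansiveness yields a \<open>\<delta> > 0\<close> such that every
  continuum \<open>B\<close> is either shrinking or satisfies \<open>diam f\<^sup>-\<^sup>n(B) \<ge> \<delta>\<close> for all \<open>n\<close>, and the second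
  alternative is preserved by limits. Each composant is a countable union of shrinking closed sets,
  so, by Baire's theorem and boundary bumping, every proper subcontinuum of \<open>H\<close> is shrinking.
  Let \<open>f\<^sup>m(H) = H\<close>. If images \<open>f\<^sup>m\<^sup>n(A\<^sub>n)\<close> of continua of diameter at least \<open>\<gamma>\<close> missed a nonempty
  open subset of \<open>H\<close> for arbitrarily large \<open>n\<close>, a limit of them would be a proper non-shrinking
  subcontinuum; hence they spread over all of \<open>H\<close>, uniformly in \<open>A\<^sub>n\<close>. This gives independence
  along the multiples of a fixed number for any finitely many open sets meeting \<open>H\<close>, and it makes
  \<open>f\<^sup>-\<^sup>m\<close> mixing on \<open>H\<close>, so that a Cantor scheme can follow every pattern of cells. Distinct points
  of the Cantor set lie in distinct composants because the two can be steered back to themselves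
  at a common time, whereas points of a composant are asymptotic.
\<close>

section \<open>Limits of continua\<close>

lemma diameter_leI:
  fixes S :: "'a::metric_space set"
  assumes "S \<noteq> {}" "\<And>x y. x \<in> S \<Longrightarrow> y \<in> S \<Longrightarrow> dist x y \<le> d"
  shows "diameter S \<le> d"
  using assms unfolding diameter_def by (auto intro!: cSUP_least)

lemma dist_le_diameter_compact:
  fixes S :: "'a::metric_space set"
  assumes "compact S" "x \<in> S" "y \<in> S"
  shows "dist x y \<le> diameter S"
  using assms compact_imp_bounded diameter_bounded_bound by blast

text \<open>The two open sets consist of the points strictly nearer to \<open>P\<close> and strictly
  nearer to \<open>Q\<close>. Nonemptiness matters because \<open>infdist\<close> to the empty set
  is 0.\<close>

lemma disjoint_closed_separated:
  fixes P Q :: "'a::metric_space set"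
  assumes "closed P" "closed Q" "P \<noteq> {}" "Q \<noteq> {}" "P \<inter> Q = {}"
  obtains U V where "open U" "open V" "P \<subseteq> U" "Q \<subseteq> V" "U \<inter> V = {}"
proof
  show "open {x. infdist x P < infdist x Q}" "open {x. infdist x Q < infdist x P}"
    by (intro open_Collect_less continuous_intros)+
  show "P \<subseteq> {x. infdist x P < infdist x Q}"
    using assms infdist_pos_not_in_closed[of Q] by force
  show "Q \<subseteq> {x. infdist x Q < infdist x P}"
    using assms infdist_pos_not_in_closed[of P] by force
qed auto

lemma continuum_imp_compact: "continuum A \<Longrightarrow> compact A"
  and continuum_imp_connected: "continuum A \<Longrightarrow> connected A"
  and continuum_imp_nonempty: "continuum A \<Longrightarrow> A \<noteq> {}"
  by (auto simp: continuum_def)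

lemma continuum_continuous_image:
  assumes "continuum A" "continuous_on A \<phi>"
  shows "continuum (\<phi> ` A)"
  using assms unfolding continuum_def
  by (auto intro: compact_continuous_image connected_continuous_image)

text \<open>The continuum \<open>L\<close> is a topological upper limit along a subsequence with convergent base
  points. Two points of \<open>L\<close> may be approached along different further subsequences, which is why
  an upper bound for the diameters only passes to the limit with a factor 2.\<close>

lemma continuum_limit:
  fixes K :: "nat \<Rightarrow> 'a::metric_space set"
  assumes X: "compact X" and K: "\<And>n. continuum (K n)" "\<And>n. K n \<subseteq> X"
  shows "\<exists>L. continuum L \<and> L \<subseteq> X \<and>
    (\<forall>(\<phi>::'a \<Rightarrow> 'a) d. continuous_on X \<phi> \<longrightarrow>
       (\<forall>\<^sub>F n in sequentially. d \<le> diameter (\<phi> ` K n)) \<longrightarrow> d \<le> diameter (\<phi> ` L)) \<and>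
    (\<forall>(\<phi>::'a \<Rightarrow> 'a) d. continuous_on X \<phi> \<longrightarrow>
       (\<forall>\<^sub>F n in sequentially. diameter (\<phi> ` K n) \<le> d) \<longrightarrow> diameter (\<phi> ` L) \<le> 2 * d) \<and>
    (\<forall>C. closed C \<longrightarrow> (\<forall>n. K n \<subseteq> C) \<longrightarrow> L \<subseteq> C)"
proof -
  have cpt_img: "compact (\<phi> ` K n)" if "continuous_on X \<phi>" for \<phi> :: "'a \<Rightarrow> 'a" and n
    using that K by (meson compact_continuous_image continuous_on_subset continuum_def)
  have "\<exists>p. p \<in> K n" for n
    using continuum_imp_nonempty[OF K(1)] by blast
  then obtain p where p: "\<And>n. p n \<in> K n" by metis
  then have pX: "\<And>n. p n \<in> X" using K by blast
  then have "\<forall>n. p n \<in> X" by blast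
  then obtain x r where r: "strict_mono (r :: nat \<Rightarrow> nat)" and px: "(p \<circ> r) \<longlonglongrightarrow> x"
    using X unfolding compact_def by meson
  define T where "T N = (\<Union>n\<in>{N..}. K (r n))" for N
  define L where "L = (\<Inter>N. closure (T N))"
  \<comment> \<open>Membership criterion: limits of points chosen in tail members belong to
    \<open>L\<close>. The index map \<open>s\<close> only has to satisfy \<open>i \<le> s i\<close>;
    it need not be monotone.\<close>
  have in_L: "y \<in> L" if a: "\<And>i. a i \<in> K (r (s i))" "\<And>i. i \<le> s i" "a \<longlonglongrightarrow> y" for a s y
  proof -
    have "y \<in> closure (T N)" for N
    proof (rule Lim_in_closed_set[OF closed_closure _ _ a(3)])
      show "\<forall>\<^sub>F i in sequentially. a i \<in> closure (T N)"
        unfolding eventually_sequentially T_def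
        using a(1,2) closure_subset by (intro exI[of _ N]) (fastforce intro: order_trans)
    qed auto
    then show ?thesis by (simp add: L_def)
  qed
  have near: "\<exists>n\<ge>N. \<exists>z\<in>K (r n). dist z y < e" if y: "y \<in> L" and e: "e > 0" for y e N
  proof -
    have "y \<in> closure (T N)" using y by (simp add: L_def)
    then obtain z where "z \<in> T N" "dist z y < e" using e by (auto simp: closure_approachable)
    then show ?thesis by (auto simp: T_def)
  qed
  have xL: "x \<in> L"
    by (rule in_L[of "p \<circ> r" "\<lambda>i. i"]) (auto simp: p px)
  have clX: "closed X" using X compact_imp_closed by blast
  have L_sub: "L \<subseteq> C" if "closed C" "\<And>n. K n \<subseteq> C" for C
  proof -
    have "T 0 \<subseteq> C" using that by (auto simp: T_def)
    then have "closure (T 0) \<subseteq> C" using that by (simp add: closure_minimal)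
    then show ?thesis by (auto simp: L_def)
  qed
  have LX: "L \<subseteq> X" using L_sub clX K by blast
  have clL: "closed L" by (auto simp: L_def)
  have cL: "compact L" using X LX clL by (metis closed_Int_compact inf.absorb1)
  \<comment> \<open>Separate \<open>P\<close> and \<open>Q\<close> by open sets \<open>U\<close> and
    \<open>V\<close>. By compactness some tail lies in \<open>U \<union> V\<close>; its members meet
    \<open>U\<close> at their base points and, for suitable large \<open>n\<close>, meet
    \<open>V\<close> near a point of \<open>Q\<close>, which contradicts connectedness.\<close>
  have no_split: False
    if PQ: "closed P" "closed Q" "Q \<noteq> {}" "P \<union> Q = L" "P \<inter> Q = {}" and xP: "x \<in> P" for P Q
  proof -
    obtain U V where UV: "open U" "open V" "P \<subseteq> U" "Q \<subseteq> V" "U \<inter> V = {}"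
      using disjoint_closed_separated[of P Q] PQ xP by blast
    have "\<exists>N. T N \<subseteq> U \<union> V"
    proof (rule ccontr)
      assume "\<not> ?thesis"
      then have "\<exists>y\<in>T N. y \<notin> U \<union> V" for N by blast
      then have "\<exists>n\<ge>N. \<exists>y\<in>K (r n). y \<notin> U \<union> V" for N
        unfolding T_def by (metis UN_E atLeast_iff)
      then obtain s a where sa: "\<And>N. s N \<ge> N" "\<And>N. a N \<in> K (r (s N))" "\<And>N. a N \<notin> U \<union> V"
        by metis
      then have "\<forall>N. a N \<in> X" using K by blast
      then obtain y q where q: "strict_mono (q :: nat \<Rightarrow> nat)" and ay: "(a \<circ> q) \<longlonglongrightarrow> y"
        using X unfolding compact_def by meson
      have "y \<in> L"
      proof (rule in_L[of "a \<circ> q" "s \<circ> q"])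
        show "i \<le> (s \<circ> q) i" for i using sa(1)[of "q i"] seq_suble[OF q, of i] by simp
      qed (auto simp: sa ay)
      moreover have "y \<in> - (U \<union> V)"
        by (rule closed_sequentially[of _ "a \<circ> q"]) (use UV sa ay in auto)
      ultimately show False using PQ UV by blast
    qed
    then obtain N where N: "T N \<subseteq> U \<union> V" by blast
    have "\<forall>\<^sub>F n in sequentially. p (r n) \<in> U"
      using topological_tendstoD[OF px UV(1)] xP UV by auto
    then obtain M where M: "\<And>n. n \<ge> M \<Longrightarrow> p (r n) \<in> U"
      by (auto simp: eventually_sequentially)
    obtain y where y: "y \<in> Q" using PQ by blast
    then obtain e where e: "e > 0" "ball y e \<subseteq> V"
      using UV by (meson open_contains_ball subsetD)
    obtain n z where nz: "n \<ge> max M N" "z \<in> K (r n)" "dist z y < e"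
      using near[of y e "max M N"] y e PQ by blast
    then have "z \<in> V" using e by (auto simp: dist_commute)
    moreover have "K (r n) \<subseteq> U \<union> V" using N nz by (auto simp: T_def)
    moreover have "U \<inter> K (r n) \<noteq> {}" using M nz p by auto
    ultimately show False
      using connectedD[of "K (r n)" U V] K UV nz by (auto simp: continuum_def)
  qed
  have "connected L"
    unfolding connected_closed_set[OF clL]
    using no_split xL by (metis Int_commute Un_iff sup_commute)
  then have contL: "continuum L" using cL xL by (auto simp: continuum_def)
  show ?thesis
  proof (intro exI[of _ L] conjI allI impI contL LX)
    fix \<phi> :: "'a \<Rightarrow> 'a" and d
    assume cont: "continuous_on X \<phi>" and ev: "\<forall>\<^sub>F n in sequentially. d \<le> diameter (\<phi> ` K n)"
    have "\<exists>a\<in>K (r n). \<exists>b\<in>K (r n). dist (\<phi> a) (\<phi> b) = diameter (\<phi> ` K (r n))" for n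
      using diameter_compact_attained[OF cpt_img[OF cont, of "r n"]] K by (auto simp: continuum_def)
    then obtain a b where ab: "\<And>n. a n \<in> K (r n)" "\<And>n. b n \<in> K (r n)"
      "\<And>n. dist (\<phi> (a n)) (\<phi> (b n)) = diameter (\<phi> ` K (r n))"
      by metis
    have abX: "a n \<in> X" "b n \<in> X" for n using ab K by blast+
    \<comment> \<open>A further subsequence makes both points realising the diameter of the image
      converge at once, so that their limits lie in \<open>L\<close>.\<close>
    then have "\<forall>n. (a n, b n) \<in> X \<times> X" by blast
    then obtain l q where q: "strict_mono (q :: nat \<Rightarrow> nat)" and l: "((\<lambda>n. (a n, b n)) \<circ> q) \<longlonglongrightarrow> l"
      and lX: "l \<in> X \<times> X"
      using compact_Times[OF X X] unfolding compact_def by meson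
    have la: "(a \<circ> q) \<longlonglongrightarrow> fst l" and lb: "(b \<circ> q) \<longlonglongrightarrow> snd l"
      using tendsto_fst[OF l] tendsto_snd[OF l] by (auto simp: o_def)
    have "fst l \<in> L" "snd l \<in> L"
      by (rule in_L[OF _ _ la, of q] in_L[OF _ _ lb, of q]; simp add: ab seq_suble[OF q])+
    moreover have "d \<le> dist (\<phi> (fst l)) (\<phi> (snd l))"
    proof (rule tendsto_lowerbound)
      show "(\<lambda>n. dist (\<phi> ((a \<circ> q) n)) (\<phi> ((b \<circ> q) n))) \<longlonglongrightarrow> dist (\<phi> (fst l)) (\<phi> (snd l))"
        by (intro tendsto_dist continuous_on_tendsto_compose[OF cont] la lb)
          (use lX abX in \<open>auto simp: mem_Times_iff intro!: always_eventually\<close>)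
      show "\<forall>\<^sub>F n in sequentially. d \<le> dist (\<phi> ((a \<circ> q) n)) (\<phi> ((b \<circ> q) n))"
        using eventually_subseq[OF strict_mono_o[OF r q] ev] by (simp add: ab)
    qed auto
    ultimately show "d \<le> diameter (\<phi> ` L)"
      using dist_le_diameter_compact[of "\<phi> ` L"] compact_continuous_image[of L \<phi>] cL LX cont
      by (meson continuous_on_subset image_eqI order_trans)
  next
    fix \<phi> :: "'a \<Rightarrow> 'a" and d
    assume cont: "continuous_on X \<phi>" and ev: "\<forall>\<^sub>F n in sequentially. diameter (\<phi> ` K n) \<le> d"
    \<comment> \<open>Every point of \<open>L\<close> is compared with the limit \<open>x\<close> of
      the base points, because these converge to \<open>x\<close> along any choice of indices
      tending to infinity.\<close>
    have le: "dist (\<phi> x) (\<phi> y) \<le> d" if y: "y \<in> L" for y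
    proof -
      have "\<forall>N. \<exists>n\<ge>N. \<exists>z\<in>K (r n). dist z y < inverse (Suc N)"
        using near[OF y] by simp
      then obtain s z where sz: "\<And>N. s N \<ge> N" "\<And>N. z N \<in> K (r (s N))"
          "\<And>N. dist (z N) y < inverse (Suc N)"
        by metis
      have zX: "z n \<in> X" for n using sz(2) K by blast
      have zy: "z \<longlonglongrightarrow> y"
        using sz(3) by (intro metric_tendsto_imp_tendsto[OF LIMSEQ_inverse_real_of_nat])
           (auto simp: less_imp_le intro!: always_eventually)
      have s: "filterlim s at_top sequentially"
        using sz(1) by (intro filterlim_at_top_mono[OF filterlim_ident]) auto
      have px': "(\<lambda>n. p (r (s n))) \<longlonglongrightarrow> x"
        using filterlim_compose[OF px s] by simp
      have rs: "filterlim (\<lambda>n. r (s n)) at_top sequentially"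
        by (rule filterlim_compose[OF filterlim_subseq[OF r] s])
      show ?thesis
      proof (rule tendsto_upperbound)
        show "(\<lambda>n. dist (\<phi> (p (r (s n)))) (\<phi> (z n))) \<longlonglongrightarrow> dist (\<phi> x) (\<phi> y)"
          by (intro tendsto_dist continuous_on_tendsto_compose[OF cont] px' zy)
            (use xL y LX pX zX in \<open>auto intro!: always_eventually\<close>)
        show "\<forall>\<^sub>F n in sequentially. dist (\<phi> (p (r (s n)))) (\<phi> (z n)) \<le> d"
          using eventually_compose_filterlim[OF ev rs]
        proof eventually_elim
          case (elim n)
          have "dist (\<phi> (p (r (s n)))) (\<phi> (z n)) \<le> diameter (\<phi> ` K (r (s n)))"
            using sz(2) p by (intro dist_le_diameter_compact cpt_img cont) auto
          with elim show ?case by linarith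
        qed
      qed auto
    qed
    show "diameter (\<phi> ` L) \<le> 2 * d"
    proof (rule diameter_leI)
      fix u v assume "u \<in> \<phi> ` L" "v \<in> \<phi> ` L"
      then obtain y z where "y \<in> L" "z \<in> L" "u = \<phi> y" "v = \<phi> z" by blast
      then show "dist u v \<le> 2 * d"
        using le[of y] le[of z] dist_triangle3[of u v "\<phi> x"] by auto
    qed (use xL in auto)
  next
    fix C assume "closed C" "\<forall>n. K n \<subseteq> C"
    then show "L \<subseteq> C" using L_sub by blast
  qed
qed

section \<open>Nested intersections of continua and boundary bumping\<close>

lemma compact_chain_subset_open:
  fixes \<C> :: "'a::metric_space set set"
  assumes "\<C> \<noteq> {}" "\<And>S. S \<in> \<C> \<Longrightarrow> compact S"
    and chain: "\<And>S T. S \<in> \<C> \<Longrightarrow> T \<in> \<C> \<Longrightarrow> S \<subseteq> T \<or> T \<subseteq> S"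
    and W: "open W" "\<Inter>\<C> \<subseteq> W"
  shows "\<exists>S\<in>\<C>. S \<subseteq> W"
proof (rule ccontr)
  assume neg: "\<not> ?thesis"
  obtain S0 where S0: "S0 \<in> \<C>" using assms by blast
  \<comment> \<open>If no member lies in \<open>W\<close>, the compact sets \<open>S - W\<close>
    have the finite intersection property, since a finite part of a chain has a least member. A
    common point then lies in the intersection of the chain but not in \<open>W\<close>.\<close>
  have "S0 \<inter> (\<Inter>S\<in>\<C>. S - W) \<noteq> {}"
  proof (rule compact_imp_fip_image)
    show "compact S0" using assms S0 by blast
    show "closed (S - W)" if "S \<in> \<C>" for S
      using assms that by (simp add: closed_Diff compact_imp_closed)
    show "S0 \<inter> (\<Inter>S\<in>\<D>. S - W) \<noteq> {}" if \<D>: "finite \<D>" "\<D> \<subseteq> \<C>" for \<D>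
    proof -
      \<comment> \<open>Inserting \<open>S0\<close> makes the finite subfamily nonempty and puts its
        least member inside \<open>S0\<close>.\<close>
      have "\<exists>M\<in>insert S0 \<D>. \<forall>S\<in>insert S0 \<D>. M \<subseteq> S"
        using \<D>
      proof (induction \<D> rule: finite_induct)
        case (insert A F)
        then obtain M where M: "M\<in>insert S0 F" "\<forall>S\<in>insert S0 F. M \<subseteq> S" by blast
        have "M \<in> \<C>" using M(1) S0 insert.prems by auto
        moreover have "A \<in> \<C>" using insert.prems by auto
        ultimately have "M \<subseteq> A \<or> A \<subseteq> M" by (rule chain)
        then show ?case
        proof
          assume "M \<subseteq> A"
          then show ?thesis using M by (intro bexI[of _ M]) auto
        next
          assume "A \<subseteq> M"
          then have "\<forall>S\<in>insert S0 (insert A F). A \<subseteq> S" using M(2) by (auto intro: order_trans)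
          then show ?thesis by (intro bexI[of _ A]) simp_all
        qed
      qed auto
      then obtain M where M: "M\<in>insert S0 \<D>" "\<forall>S\<in>insert S0 \<D>. M \<subseteq> S" by blast
      then have "M \<in> \<C>" using S0 \<D> by auto
      then obtain x where "x \<in> M" "x \<notin> W" using neg by auto
      then have "x \<in> S0 \<inter> (\<Inter>S\<in>\<D>. S - W)" using M(2) by auto
      then show ?thesis by blast
    qed
  qed
  then obtain x where "x \<in> (\<Inter>S\<in>\<C>. S - W)" by blast
  then have "x \<in> S - W" if "S \<in> \<C>" for S using that by (rule INT_D)
  then have "x \<in> \<Inter>\<C>" "x \<notin> W" using S0 by auto
  then show False using W(2) by auto
qed

text \<open>Every open neighbourhood of the intersection contains a member of the chain. With the
  neighbourhood \<open>{}\<close> this excludes an empty intersection; with the union of two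
  separating open sets it would disconnect a member.\<close>

lemma continuum_Inter_chain:
  fixes \<C> :: "'a::metric_space set set"
  assumes ne: "\<C> \<noteq> {}" and cont: "\<And>S. S \<in> \<C> \<Longrightarrow> continuum S"
    and chain: "\<And>S T. S \<in> \<C> \<Longrightarrow> T \<in> \<C> \<Longrightarrow> S \<subseteq> T \<or> T \<subseteq> S"
  shows "continuum (\<Inter>\<C>)"
proof -
  have cpt: "compact S" if "S \<in> \<C>" for S using cont that by (simp add: continuum_def)
  note sub = compact_chain_subset_open[OF ne cpt chain]
  have cl: "closed (\<Inter>\<C>)" using cpt by (simp add: closed_Inter compact_imp_closed)
  obtain S0 where "S0 \<in> \<C>" using ne by blast
  then have "compact (\<Inter>\<C>)"
    using cpt cl by (metis Inf_lower closed_Int_compact inf.absorb1)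
  moreover have "\<Inter>\<C> \<noteq> {}"
  proof
    assume "\<Inter>\<C> = {}"
    then obtain S where "S \<in> \<C>" "S \<subseteq> {}" using sub[of "{}"] by auto
    then show False using cont[of S] continuum_imp_nonempty by blast
  qed
  moreover have "connected (\<Inter>\<C>)"
    unfolding connected_closed_set[OF cl]
  proof (rule notI, elim exE conjE)
    fix P Q
    assume PQ: "closed P" "closed Q" "P \<noteq> {}" "Q \<noteq> {}" "P \<union> Q = \<Inter>\<C>" "P \<inter> Q = {}"
    obtain U V where UV: "open U" "open V" "P \<subseteq> U" "Q \<subseteq> V" "U \<inter> V = {}"
      using disjoint_closed_separated[of P Q] PQ by metis
    have "\<Inter>\<C> \<subseteq> U \<union> V" using PQ UV by blast
    then obtain S where S: "S \<in> \<C>" "S \<subseteq> U \<union> V" using sub[of "U \<union> V"] UV by auto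
    have "P \<subseteq> S" "Q \<subseteq> S" using PQ S by blast+
    then show False
      using connectedD[of S U V] cont[OF S(1)] S UV PQ unfolding continuum_def by blast
  qed
  ultimately show ?thesis unfolding continuum_def by (intro conjI)
qed

text \<open>The pairs in \<open>S \<times> S\<close> whose images are at least \<open>d\<close>
  apart form nonempty compact sets, again a chain, so some pair belongs to all of them. This
  preserves the lower bound on backward images in the Zorn argument of
  \<open>minimal_not_shrinking\<close>.\<close>

lemma diameter_Inter_chain:
  fixes \<C> :: "'a::metric_space set set" and \<phi> :: "'a \<Rightarrow> 'a"
  assumes ne: "\<C> \<noteq> {}" and cont: "\<And>S. S \<in> \<C> \<Longrightarrow> continuum S"
    and chain: "\<And>S T. S \<in> \<C> \<Longrightarrow> T \<in> \<C> \<Longrightarrow> S \<subseteq> T \<or> T \<subseteq> S"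
    and \<phi>: "continuous_on (\<Union>\<C>) \<phi>" and d: "\<And>S. S \<in> \<C> \<Longrightarrow> d \<le> diameter (\<phi> ` S)"
  shows "d \<le> diameter (\<phi> ` \<Inter>\<C>)"
proof -
  define E where "E S = {p \<in> S \<times> S. d \<le> dist (\<phi> (fst p)) (\<phi> (snd p))}" for S
  have cpt: "compact S" if "S \<in> \<C>" for S using cont that by (simp add: continuum_def)
  have \<phi>S: "continuous_on S \<phi>" if "S \<in> \<C>" for S
    using \<phi> that by (meson Union_upper continuous_on_subset)
  have cE: "compact (E S)" if "S \<in> \<C>" for S
  proof -
    have "continuous_on (S \<times> S) (\<lambda>p. dist (\<phi> (fst p)) (\<phi> (snd p)))"
      by (intro continuous_on_dist continuous_on_compose2[OF \<phi>S[OF that]] continuous_intros) auto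
    then have "closedin (top_of_set (S \<times> S))
        ((S \<times> S) \<inter> (\<lambda>p. dist (\<phi> (fst p)) (\<phi> (snd p))) -` {d..})"
      using continuous_closedin_preimage closed_atLeast by blast
    moreover have "((S \<times> S) \<inter> (\<lambda>p. dist (\<phi> (fst p)) (\<phi> (snd p))) -` {d..}) = E S"
      by (auto simp: E_def)
    ultimately show ?thesis
      using closedin_compact compact_Times cpt that by metis
  qed
  have neE: "E S \<noteq> {}" if S: "S \<in> \<C>" for S
  proof -
    have "\<phi> ` S \<noteq> {}" "compact (\<phi> ` S)"
      using cont[OF S] \<phi>S[OF S] by (auto simp: continuum_def compact_continuous_image)
    then obtain a b where "a \<in> S" "b \<in> S" "dist (\<phi> a) (\<phi> b) = diameter (\<phi> ` S)"
      using diameter_compact_attained[of "\<phi> ` S"] by auto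
    then have "(a, b) \<in> E S" using d[OF S] by (auto simp: E_def)
    then show ?thesis by blast
  qed
  have "\<exists>S\<in>E ` \<C>. S \<subseteq> {}" if "\<Inter>(E ` \<C>) = {}"
  proof (rule compact_chain_subset_open)
    fix S T assume "S \<in> E ` \<C>" "T \<in> E ` \<C>"
    then obtain S' T' where *: "S' \<in> \<C>" "T' \<in> \<C>" "S = E S'" "T = E T'" by blast
    then have "S' \<subseteq> T' \<or> T' \<subseteq> S'" using chain by blast
    then show "S \<subseteq> T \<or> T \<subseteq> S" unfolding * E_def by blast
  qed (use ne cE that in auto)
  then obtain p where p: "p \<in> \<Inter>(E ` \<C>)" using neE by blast
  have pE: "p \<in> E S" if "S \<in> \<C>" for S using p that by blast
  have "fst p \<in> S" "snd p \<in> S" if "S \<in> \<C>" for S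
    using pE[OF that] by (auto simp: E_def)
  then have "fst p \<in> \<Inter>\<C>" "snd p \<in> \<Inter>\<C>" by blast+
  then have "\<phi> (fst p) \<in> \<phi> ` \<Inter>\<C>" "\<phi> (snd p) \<in> \<phi> ` \<Inter>\<C>" by (simp_all only: imageI)
  obtain S0 where S0: "S0 \<in> \<C>" using ne by blast
  have "\<Inter>\<C> \<subseteq> \<Union>\<C>" by (rule order_trans[OF Inter_lower[OF S0] Union_upper[OF S0]])
  then have "continuous_on (\<Inter>\<C>) \<phi>" by (rule continuous_on_subset[OF \<phi>])
  then have "compact (\<phi> ` \<Inter>\<C>)"
    by (rule compact_continuous_image)
      (rule continuum_imp_compact[OF continuum_Inter_chain[OF ne cont chain]])
  from dist_le_diameter_compact[OF this \<open>\<phi> (fst p) \<in> _\<close> \<open>\<phi> (snd p) \<in> _\<close>]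
  have "dist (\<phi> (fst p)) (\<phi> (snd p)) \<le> diameter (\<phi> ` \<Inter>\<C>)" .
  then show ?thesis using pE[OF S0] by (simp add: E_def)
qed

text \<open>Boundary bumping: the component of \<open>x\<close> in \<open>S \<inter> T\<close>
  reaches the frontier of \<open>S \<inter> T\<close> relative to \<open>S\<close>, and this
  frontier lies in \<open>closure (S - T)\<close>.\<close>

lemma component_meets_closure_complement:
  fixes S :: "'a::metric_space set"
  assumes S: "continuum S" and T: "closed T" "\<not> S \<subseteq> T" and x: "x \<in> S" "x \<in> T"
  obtains C where "continuum C" "C \<subseteq> S \<inter> T" "x \<in> C" "C \<inter> closure (S - T) \<noteq> {}"
proof -
  define C where "C = connected_component_of_set (subtopology (top_of_set S) (S \<inter> T)) x"
  have sub: "subtopology (top_of_set S) (S \<inter> T) = top_of_set (S \<inter> T)"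
    unfolding subtopology_subtopology Int_left_absorb ..
  have C: "C \<in> connected_components_of (subtopology (top_of_set S) (S \<inter> T))"
    using x by (simp add: C_def connected_component_in_connected_components_of)
  have cST: "compact (S \<inter> T)" using S T by (simp add: compact_Int_closed continuum_imp_compact)
  have Csub: "C \<subseteq> S \<inter> T" and xC: "x \<in> C" and "connected C"
    using connected_components_of_subset[OF C] connectedin_connected_components_of[OF C] x
    by (auto simp: C_def sub connected_component_of_refl connectedin_subtopology)
  moreover have "closedin (top_of_set (S \<inter> T)) C"
    using closedin_connected_components_of[OF C] by (simp add: sub)
  ultimately have "continuum C"
    using closedin_compact[OF cST] unfolding continuum_def by blast
  have "C \<inter> (top_of_set S) frontier_of (S \<inter> T) \<noteq> {}"
  proof (rule boundary_bumping_theorem_closed[OF _ _ _ _ _ C])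
    show "Hausdorff_space (top_of_set S)"
      by (simp add: Hausdorff_space_subtopology)
    show "closedin (top_of_set S) (S \<inter> T)" using T by (simp add: closedin_closed_Int)
    show "connected_space (top_of_set S)"
      using continuum_imp_connected[OF S] by (simp add: connected_space_subtopology)
  qed (use S T in \<open>auto simp: continuum_def compact_space_subtopology\<close>)
  moreover have "(top_of_set S) frontier_of (S \<inter> T) \<subseteq> closure (S - T)"
  proof -
    have "S \<inter> (S - S \<inter> T) = S - T" by blast
    then show ?thesis by (simp add: frontier_of_closures closure_of_subtopology le_infI2)
  qed
  ultimately show thesis using that[of C] \<open>continuum C\<close> Csub xC by blast
qed

section \<open>Expanding homeomorphisms and shrinking continua\<close>

lemma homeomorphism_funpow:
  assumes "homeomorphism X X f g"
  shows "homeomorphism X X (f ^^ n) (g ^^ n)"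
proof (induction n)
  case 0
  then show ?case by (simp add: homeomorphism_def)
next
  case (Suc n)
  have "homeomorphism X X (f \<circ> f ^^ n) (g ^^ n \<circ> g)"
    by (rule homeomorphism_compose[OF Suc assms])
  then show ?case by (simp add: funpow_Suc_right del: funpow.simps) (simp add: funpow_swap1 o_def funpow_Suc_right)
qed

lemma homeomorphism_funpow_cancel:
  assumes "homeomorphism X X f g" "x \<in> X" "j \<le> n"
  shows "(g ^^ j) ((f ^^ n) x) = (f ^^ (n - j)) x"
proof -
  have "(f ^^ (n - j)) x \<in> X"
    using homeomorphism_funpow[OF assms(1), of "n - j"] assms(2) by (auto simp: homeomorphism_def)
  moreover have "(f ^^ n) x = (f ^^ j) ((f ^^ (n - j)) x)"
    using assms(3) funpow_add[of j "n - j" f] by simp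
  ultimately show ?thesis
    using homeomorphism_funpow[OF assms(1), of j] by (simp add: homeomorphism_def)
qed

lemma uniformly_continuous_funpow_bound:
  fixes f :: "'a::metric_space \<Rightarrow> 'a"
  assumes "compact X" "\<And>n. continuous_on X (f ^^ n)" "e > 0"
  shows "\<exists>d>0. \<forall>x\<in>X. \<forall>y\<in>X. dist x y < d \<longrightarrow> (\<forall>i\<le>N::nat. dist ((f ^^ i) x) ((f ^^ i) y) < e)"
proof (induction N)
  case 0
  then show ?case using assms(3) by auto
next
  case (Suc N)
  then obtain d where d: "d > 0"
    "\<And>x y i. x \<in> X \<Longrightarrow> y \<in> X \<Longrightarrow> dist x y < d \<Longrightarrow> i \<le> N \<Longrightarrow> dist ((f ^^ i) x) ((f ^^ i) y) < e"
    by blast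
  have "uniformly_continuous_on X (f ^^ Suc N)"
    using assms compact_uniformly_continuous by blast
  then obtain d' where d': "d' > 0"
    "\<And>x y. x \<in> X \<Longrightarrow> y \<in> X \<Longrightarrow> dist x y < d' \<Longrightarrow> dist ((f ^^ Suc N) x) ((f ^^ Suc N) y) < e"
    unfolding uniformly_continuous_on_def using assms(3) by metis
  show ?case
  proof (intro exI[of _ "min d d'"] conjI ballI impI allI)
    fix x y i assume "x \<in> X" "y \<in> X" "dist x y < min d d'" "i \<le> Suc N"
    then show "dist ((f ^^ i) x) ((f ^^ i) y) < e"
      using d(2)[of x y i] d'(2)[of x y] by (cases "i = Suc N") auto
  qed (use d d' in auto)
qed

lemma nondegenerate_iff_diameter_pos:
  fixes A :: "'a::metric_space set"
  assumes "compact A" "A \<noteq> {}"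
  shows "nondegenerate A \<longleftrightarrow> diameter A > 0"
proof
  assume "nondegenerate A"
  then obtain x y where "x \<in> A" "y \<in> A" "x \<noteq> y" by (auto simp: nondegenerate_def)
  then show "diameter A > 0"
    using dist_le_diameter_compact[OF assms(1), of x y] by (smt (verit) zero_less_dist_iff)
next
  assume "diameter A > 0"
  moreover obtain x y where "x \<in> A" "y \<in> A" "dist x y = diameter A"
    using diameter_compact_attained[OF assms] by blast
  ultimately have "x \<noteq> y" by auto
  then show "nondegenerate A" using \<open>x \<in> A\<close> \<open>y \<in> A\<close> by (auto simp: nondegenerate_def)
qed

text \<open>Compactness turns the expansion time of a single continuum into a bound depending on
  \<open>\<gamma>\<close> only. For \<open>\<gamma> = c / 3\<close> this shows that large diameters
  recur within \<open>M\<close> steps, and uniform continuity of the iterates up to \<open>M\<close>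
  prevents the diameter from falling below a fixed \<open>\<delta>\<close> in between.\<close>

lemma pos_cw_expansive_uniform:
  fixes f :: "'a::metric_space \<Rightarrow> 'a"
  assumes X: "compact X" and hom: "homeomorphism X X f g" and cw: "pos_cw_expansive X f"
  obtains \<delta> where "\<delta> > 0"
    "\<And>\<gamma>. \<gamma> > 0 \<Longrightarrow> \<exists>N. \<forall>A n. continuum A \<and> A \<subseteq> X \<and> \<gamma> \<le> diameter A \<and> N \<le> n \<longrightarrow>
       \<delta> \<le> diameter ((f ^^ n) ` A)"
proof -
  have cont: "continuous_on X (f ^^ n)" and img: "(f ^^ n) ` X = X" for n
    using homeomorphism_funpow[OF hom, of n] by (auto simp: homeomorphism_def)
  have fA: "continuum ((f ^^ n) ` A)" "(f ^^ n) ` A \<subseteq> X" if "continuum A" "A \<subseteq> X" for A n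
    using continuum_continuous_image[OF that(1) continuous_on_subset[OF cont that(2)]] img that(2)
    by blast+
  obtain c where c: "c > 0"
    "\<And>A. A \<subseteq> X \<Longrightarrow> continuum A \<Longrightarrow> nondegenerate A \<Longrightarrow> \<exists>n\<ge>1. diameter ((f ^^ n) ` A) > c"
    using cw by (auto simp: pos_cw_expansive_def)
  \<comment> \<open>The threshold \<open>c / 3\<close> pays for the factor 2 in
    \<open>continuum_limit\<close>: a limit of counterexamples has diameter at least
    \<open>\<gamma>\<close>, hence is nondegenerate, while its images at all times
    \<open>n \<ge> 1\<close> have diameter at most \<open>2 * (c / 3)\<close>, which is below
    \<open>c\<close>.\<close>
  have step: "\<exists>N. \<forall>A. continuum A \<and> A \<subseteq> X \<and> \<gamma> \<le> diameter A \<longrightarrow>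
      (\<exists>n\<in>{1..N}. c / 3 < diameter ((f ^^ n) ` A))" if \<gamma>: "\<gamma> > 0" for \<gamma>
  proof (rule ccontr)
    assume "\<not> ?thesis"
    then have "\<forall>N. \<exists>A. continuum A \<and> A \<subseteq> X \<and> \<gamma> \<le> diameter A \<and>
        (\<forall>n\<in>{1..N}. diameter ((f ^^ n) ` A) \<le> c / 3)"
      by (simp add: not_less)
    from choice[OF this] obtain A where
      "\<forall>N. continuum (A N) \<and> A N \<subseteq> X \<and> \<gamma> \<le> diameter (A N) \<and>
        (\<forall>n\<in>{1..N}. diameter ((f ^^ n) ` A N) \<le> c / 3)" ..
    then have A: "\<And>N. continuum (A N)" "\<And>N. A N \<subseteq> X" "\<And>N. \<gamma> \<le> diameter (A N)"
      "\<And>N n. n \<in> {1..N} \<Longrightarrow> diameter ((f ^^ n) ` A N) \<le> c / 3"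
      by simp_all
    obtain L where L: "continuum L" "L \<subseteq> X"
      and lower: "\<forall>(\<phi>::'a \<Rightarrow> 'a) d. continuous_on X \<phi> \<longrightarrow>
       (\<forall>\<^sub>F n in sequentially. d \<le> diameter (\<phi> ` A n)) \<longrightarrow> d \<le> diameter (\<phi> ` L)"
      and upper: "\<forall>(\<phi>::'a \<Rightarrow> 'a) d. continuous_on X \<phi> \<longrightarrow>
       (\<forall>\<^sub>F n in sequentially. diameter (\<phi> ` A n) \<le> d) \<longrightarrow> diameter (\<phi> ` L) \<le> 2 * d"
      using continuum_limit[of X A, OF X A(1,2)] by (elim exE conjE) (rule that)
    have "\<gamma> \<le> diameter L" using lower[rule_format, of "\<lambda>x. x" \<gamma>] A(3) by simp
    then have "nondegenerate L"
      using L \<gamma> nondegenerate_iff_diameter_pos[of L] by (simp add: continuum_def)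
    then obtain n where n: "n \<ge> 1" "diameter ((f ^^ n) ` L) > c" using c L by blast
    have "diameter ((f ^^ n) ` L) \<le> 2 * (c / 3)"
    proof (rule upper[rule_format, OF cont])
      show "\<forall>\<^sub>F k in sequentially. diameter ((f ^^ n) ` A k) \<le> c / 3"
        unfolding eventually_sequentially using A(4) n(1) by (intro exI[of _ n]) auto
    qed
    then show False using n c by simp
  qed
  obtain M where M: "\<And>A. continuum A \<Longrightarrow> A \<subseteq> X \<Longrightarrow> c / 3 \<le> diameter A \<Longrightarrow>
      \<exists>n\<in>{1..M}. c / 3 < diameter ((f ^^ n) ` A)"
    using step[of "c / 3"] c(1) by auto
  obtain \<delta> where \<delta>: "\<delta> > 0" "\<And>x y i. x \<in> X \<Longrightarrow> y \<in> X \<Longrightarrow> dist x y < \<delta> \<Longrightarrow> i \<le> M \<Longrightarrow>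
      dist ((f ^^ i) x) ((f ^^ i) y) < c / 3"
    using uniformly_continuous_funpow_bound[OF X cont, of "c / 3" M] c(1) by auto
  show thesis
  proof (rule that[OF \<delta>(1)])
    fix \<gamma> :: real assume "\<gamma> > 0"
    then obtain N where N: "\<And>A. continuum A \<Longrightarrow> A \<subseteq> X \<Longrightarrow> \<gamma> \<le> diameter A \<Longrightarrow>
        \<exists>n\<in>{1..N}. c / 3 < diameter ((f ^^ n) ` A)"
      using step by blast
    show "\<exists>N. \<forall>A n. continuum A \<and> A \<subseteq> X \<and> \<gamma> \<le> diameter A \<and> N \<le> n \<longrightarrow>
        \<delta> \<le> diameter ((f ^^ n) ` A)"
    proof (intro exI[of _ N] allI impI, elim conjE, rule ccontr)
      fix A n
      assume A: "continuum A" "A \<subseteq> X" "\<gamma> \<le> diameter A" "N \<le> n" "\<not> \<delta> \<le> diameter ((f ^^ n) ` A)"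
      \<comment> \<open>\<open>Max S\<close> is the last time up to \<open>n\<close> at which the
        image is large. The next large time \<open>i + t\<close> comes after \<open>n\<close> by
        maximality, but by at most \<open>M\<close> steps; an image of diameter below
        \<open>\<delta>\<close> at time \<open>n\<close> cannot exceed \<open>c / 3\<close> that
        soon.\<close>
      define S where "S = {t. t \<le> n \<and> c / 3 < diameter ((f ^^ t) ` A)}"
      have "finite S" by (simp add: S_def)
      moreover have "S \<noteq> {}" using N[OF A(1-3)] A(4) by (force simp: S_def)
      ultimately have "Max S \<in> S" and S_le: "\<And>t. t \<in> S \<Longrightarrow> t \<le> Max S" by auto
      define t where "t = Max S"
      have t: "t \<le> n" "c / 3 < diameter ((f ^^ t) ` A)"
        using \<open>Max S \<in> S\<close> by (auto simp: S_def t_def)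
      obtain i where i: "i \<in> {1..M}" "c / 3 < diameter ((f ^^ i) ` (f ^^ t) ` A)"
        using M[OF fA[OF A(1,2), of t]] t(2) by auto
      then have ti: "c / 3 < diameter ((f ^^ (i + t)) ` A)"
        by (simp add: funpow_add image_comp)
      have "\<not> i + t \<le> n"
        using S_le[of "i + t"] ti i(1) by (auto simp: S_def t_def)
      then have j: "i + t - n \<le> M" "i + t = (i + t - n) + n" using t(1) i(1) by auto
      have "(f ^^ (i + t)) ` A = (f ^^ (i + t - n)) ` (f ^^ n) ` A"
        by (subst j(2)) (simp only: funpow_add image_comp)
      moreover have "diameter ((f ^^ (i + t - n)) ` (f ^^ n) ` A) \<le> c / 3"
      proof (rule diameter_leI)
        fix u v assume "u \<in> (f ^^ (i + t - n)) ` (f ^^ n) ` A" "v \<in> (f ^^ (i + t - n)) ` (f ^^ n) ` A"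
        then obtain x y where xy: "x \<in> (f ^^ n) ` A" "y \<in> (f ^^ n) ` A"
          "u = (f ^^ (i + t - n)) x" "v = (f ^^ (i + t - n)) y" by blast
        have "dist x y \<le> diameter ((f ^^ n) ` A)"
          using dist_le_diameter_compact[OF continuum_imp_compact[OF fA(1)[OF A(1,2)]]] xy by blast
        then have "dist x y < \<delta>" using A(5) by simp
        then have "dist u v < c / 3"
          unfolding xy(3,4) using xy(1,2) fA(2)[OF A(1,2), of n] j(1) by (intro \<delta>(2)) auto
        then show "dist u v \<le> c / 3" by simp
      qed (use A(1) in \<open>simp add: continuum_def\<close>)
      ultimately show False using ti by simp
    qed
  qed
qed

section \<open>The dichotomy between shrinking and uniformly large continua\<close>

locale expanding_homeo =
  fixes X :: "'a::metric_space set" and f g :: "'a \<Rightarrow> 'a" and \<delta> :: real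
  assumes compact_X: "compact X" and homeo: "homeomorphism X X f g" and \<delta>_pos: "\<delta> > 0"
    and expanding: "\<And>\<gamma>. \<gamma> > 0 \<Longrightarrow> \<exists>N. \<forall>A n. continuum A \<and> A \<subseteq> X \<and> \<gamma> \<le> diameter A \<and> N \<le> n \<longrightarrow>
       \<delta> \<le> diameter ((f ^^ n) ` A)"
begin

lemma funpow_cont: "continuous_on X (f ^^ n)" "continuous_on X (g ^^ n)"
  and funpow_image: "(f ^^ n) ` X = X" "(g ^^ n) ` X = X"
  using homeomorphism_funpow[OF homeo, of n] by (auto simp: homeomorphism_def)

lemma funpow_cancel:
  assumes "x \<in> X" "j \<le> n"
  shows "(g ^^ j) ((f ^^ n) x) = (f ^^ (n - j)) x" "(f ^^ j) ((g ^^ n) x) = (g ^^ (n - j)) x"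
  using homeomorphism_funpow_cancel homeo homeomorphism_sym assms by blast+

lemma continuum_funpow_image:
  assumes "continuum A" "A \<subseteq> X"
  shows "continuum ((f ^^ n) ` A)" "(f ^^ n) ` A \<subseteq> X"
    "continuum ((g ^^ n) ` A)" "(g ^^ n) ` A \<subseteq> X"
  using continuum_continuous_image[OF assms(1) continuous_on_subset[OF _ assms(2)]]
    funpow_cont funpow_image assms(2) by blast+

text \<open>Defined for arbitrary sets, since the closed pieces of a cover are tested as well; the
  empty set shrinks because its diameter is 0.\<close>

definition shrinks :: "'a set \<Rightarrow> bool" where
  "shrinks B \<longleftrightarrow> (\<lambda>n. diameter ((g ^^ n) ` B)) \<longlonglongrightarrow> 0"

text \<open>The expansion property is applied to the image of \<open>A\<close> under
  \<open>g ^^ n\<close>, which \<open>n - j\<close> forward steps carry to the image under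
  \<open>g ^^ j\<close>. The number \<open>N\<close> depends on \<open>\<gamma>\<close>
  only.\<close>

lemma diameter_backward:
  assumes "\<gamma> > 0"
  shows "\<exists>N. \<forall>A j n. continuum A \<and> A \<subseteq> X \<and> \<gamma> \<le> diameter ((g ^^ n) ` A) \<and> j + N \<le> n \<longrightarrow>
    \<delta> \<le> diameter ((g ^^ j) ` A)"
proof -
  obtain N where N: "\<And>A n. continuum A \<Longrightarrow> A \<subseteq> X \<Longrightarrow> \<gamma> \<le> diameter A \<Longrightarrow> N \<le> n \<Longrightarrow>
       \<delta> \<le> diameter ((f ^^ n) ` A)"
    using expanding[OF assms] by blast
  show ?thesis
  proof (intro exI[of _ N] allI impI, elim conjE)
    fix A j n
    assume A: "continuum A" "A \<subseteq> X" "\<gamma> \<le> diameter ((g ^^ n) ` A)" "j + N \<le> n"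
    have "(f ^^ (n - j)) ` (g ^^ n) ` A = (g ^^ j) ` A"
      unfolding image_image using A by (intro image_cong) (auto simp: funpow_cancel subset_iff)
    then show "\<delta> \<le> diameter ((g ^^ j) ` A)"
      using N[OF continuum_funpow_image(3,4)[OF A(1,2)] A(3), of "n - j"] A(4) by simp
  qed
qed

text \<open>Some \<open>\<gamma> > 0\<close> is reached by the diameters at arbitrarily late times
  \<open>n\<close>; moving forward from such an \<open>n\<close> to time \<open>j\<close> makes the
  diameter at least \<open>\<delta>\<close>.\<close>

lemma not_shrinks_imp_large:
  assumes B: "continuum B" "B \<subseteq> X" and "\<not> shrinks B"
  shows "\<delta> \<le> diameter ((g ^^ j) ` B)"
proof -
  obtain \<gamma> where \<gamma>: "\<gamma> > 0" and *: "\<And>N. \<exists>n\<ge>N. \<gamma> \<le> dist (diameter ((g ^^ n) ` B)) 0"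
    using assms(3) by (auto simp: shrinks_def lim_sequentially not_less)
  obtain N where N: "\<And>A j n. continuum A \<Longrightarrow> A \<subseteq> X \<Longrightarrow> \<gamma> \<le> diameter ((g ^^ n) ` A) \<Longrightarrow>
      j + N \<le> n \<Longrightarrow> \<delta> \<le> diameter ((g ^^ j) ` A)"
    using diameter_backward[OF \<gamma>] by blast
  obtain n where "n \<ge> j + N" "\<gamma> \<le> dist (diameter ((g ^^ n) ` B)) 0" using * by blast
  moreover have "0 \<le> diameter ((g ^^ n) ` B)"
    using continuum_funpow_image(3)[OF B] by (simp add: diameter_ge_0 compact_imp_bounded continuum_def)
  ultimately show ?thesis using N[OF B, of n j] by simp
qed

text \<open>By the dichotomy a single time with a backward image smaller than
  \<open>\<delta>\<close> suffices. Non-shrinking thus becomes a family of lower bounds on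
  diameters, which survive limits and nested intersections.\<close>

lemma shrinks_iff_small:
  assumes "continuum B" "B \<subseteq> X"
  shows "shrinks B \<longleftrightarrow> (\<exists>n. diameter ((g ^^ n) ` B) < \<delta>)"
proof
  assume "shrinks B"
  then have "\<forall>\<^sub>F n in sequentially. diameter ((g ^^ n) ` B) < \<delta>"
    unfolding shrinks_def using \<delta>_pos order_tendstoD(2) by blast
  then show "\<exists>n. diameter ((g ^^ n) ` B) < \<delta>" by (auto simp: eventually_sequentially)
qed (use not_shrinks_imp_large[OF assms] in \<open>metis not_less\<close>)

end

section \<open>Baire category and countable covers by shrinking sets\<close>

lemma compact_Baire_cover:
  fixes B :: "'a::metric_space set"
  assumes B: "compact B" "B \<noteq> {}" and S: "\<And>k. closed (S k)" "B \<subseteq> (\<Union>k::nat. S k)"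
  obtains k W where "open W" "B \<inter> W \<noteq> {}" "B \<inter> W \<subseteq> S k"
proof -
  have "\<exists>k. top_of_set B interior_of (B \<inter> S k) \<noteq> {}"
  proof (rule ccontr)
    assume neg: "\<not> ?thesis"
    have "top_of_set B interior_of \<Union>(range (\<lambda>k. B \<inter> S k)) = {}"
    proof (rule Baire_category_alt)
      have "compact_space (top_of_set B)" using B by (simp add: compact_space_subtopology)
      moreover have "Hausdorff_space (top_of_set B)" by (simp add: Hausdorff_space_subtopology)
      ultimately show "completely_metrizable_space (top_of_set B) \<or>
          locally_compact_space (top_of_set B) \<and> regular_space (top_of_set B)"
        by (simp add: compact_imp_locally_compact_space compact_Hausdorff_imp_regular_space)
    next
      fix T assume "T \<in> range (\<lambda>k. B \<inter> S k)"
      then show "closedin (top_of_set B) T \<and> top_of_set B interior_of T = {}"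
        using neg S(1) by (auto simp: closedin_closed_Int)
    qed simp
    moreover have "\<Union>(range (\<lambda>k. B \<inter> S k)) = topspace (top_of_set B)" using S(2) by auto
    ultimately have "topspace (top_of_set B) = {}" by (metis interior_of_topspace)
    then show False using B(2) by simp
  qed
  then obtain k where k: "top_of_set B interior_of (B \<inter> S k) \<noteq> {}" by blast
  have "openin (top_of_set B) (top_of_set B interior_of (B \<inter> S k))" by simp
  then obtain W where W: "open W" "top_of_set B interior_of (B \<inter> S k) = B \<inter> W"
    unfolding openin_open by blast
  then have "B \<inter> W \<subseteq> S k" using interior_of_subset[of "top_of_set B" "B \<inter> S k"] by auto
  with W k that show thesis by metis
qed

context expanding_homeo
begin

text \<open>For each fixed \<open>j\<close> the bound only has to hold eventually, so the
  \<open>K n\<close> themselves may shrink, as long as they do so later and later.\<close>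

lemma limit_not_shrinks:
  assumes K: "\<And>n. continuum (K n)" "\<And>n. K n \<subseteq> X"
    and d: "\<And>j. \<forall>\<^sub>F n in sequentially. \<delta> \<le> diameter ((g ^^ j) ` K n)"
    and C: "closed C" "\<And>n. K n \<subseteq> C"
  obtains L where "continuum L" "L \<subseteq> X" "L \<subseteq> C" "\<not> shrinks L"
proof -
  obtain L where L: "continuum L" "L \<subseteq> X"
      and lower: "\<forall>(\<phi>::'a \<Rightarrow> 'a) d. continuous_on X \<phi> \<longrightarrow>
       (\<forall>\<^sub>F n in sequentially. d \<le> diameter (\<phi> ` K n)) \<longrightarrow> d \<le> diameter (\<phi> ` L)"
      and CL: "\<forall>C. closed C \<longrightarrow> (\<forall>n. K n \<subseteq> C) \<longrightarrow> L \<subseteq> C"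
    using continuum_limit[of X K, OF compact_X K] by (elim exE conjE) (rule that)
  have "\<delta> \<le> diameter ((g ^^ j) ` L)" for j
    by (rule lower[rule_format, OF funpow_cont(2) d])
  then have "\<not> shrinks L" using shrinks_iff_small[OF L] by (simp add: not_less)
  then show thesis using that[OF L] CL C by blast
qed

lemma minimal_not_shrinking:
  assumes B: "continuum B" "B \<subseteq> X" "\<not> shrinks B"
  obtains M where "continuum M" "M \<subseteq> B" "\<not> shrinks M"
    "\<forall>C. continuum C \<and> C \<subset> M \<longrightarrow> shrinks C"
proof -
  define \<M> where "\<M> = {M. continuum M \<and> M \<subseteq> B \<and> \<not> shrinks M}"
  \<comment> \<open>\<open>subset_Zorn_nonempty\<close> produces maximal sets, so it is applied to
    complements. A chain of complements corresponds to a chain \<open>\<D>\<close> of continua,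
    whose intersection is again a non-shrinking continuum.\<close>
  have "\<exists>M\<in>uminus ` \<M>. \<forall>Y\<in>uminus ` \<M>. M \<subseteq> Y \<longrightarrow> Y = M"
  proof (rule subset_Zorn_nonempty)
    show "uminus ` \<M> \<noteq> {}" using B by (auto simp: \<M>_def)
    fix \<C> :: "'a set set"
    assume ne: "\<C> \<noteq> {}" and ch: "subset.chain (uminus ` \<M>) \<C>"
    define \<D> where "\<D> = uminus ` \<C>"
    have D: "\<D> \<noteq> {}" "\<D> \<subseteq> \<M>" using ne ch by (auto simp: \<D>_def subset_chain_def)
    have chain: "S \<subseteq> T \<or> T \<subseteq> S" if "S \<in> \<D>" "T \<in> \<D>" for S T
    proof -
      obtain S' T' where "S' \<in> \<C>" "T' \<in> \<C>" "S = - S'" "T = - T'"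
        using \<open>S \<in> \<D>\<close> \<open>T \<in> \<D>\<close> unfolding \<D>_def by (elim imageE)
      moreover have "S' \<subseteq> T' \<or> T' \<subseteq> S'"
        using ch \<open>S' \<in> \<C>\<close> \<open>T' \<in> \<C>\<close> by (simp add: subset_chain_def)
      ultimately show ?thesis by (simp add: disj_commute)
    qed
    have cont: "continuum S" and large: "\<not> shrinks S" and SB: "S \<subseteq> B" if "S \<in> \<D>" for S
      using D(2) that by (auto simp: \<M>_def)
    obtain S0 where S0: "S0 \<in> \<D>" using D(1) by blast
    have I: "continuum (\<Inter>\<D>)" by (rule continuum_Inter_chain[OF D(1) cont chain])
    have IB: "\<Inter>\<D> \<subseteq> B" by (rule order_trans[OF Inter_lower[OF S0] SB[OF S0]])
    have UX: "\<Union>\<D> \<subseteq> X" using SB B(2) by (meson Union_least order_trans)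
    have "\<delta> \<le> diameter ((g ^^ j) ` \<Inter>\<D>)" for j
    proof (rule diameter_Inter_chain[OF D(1) cont chain])
      show "continuous_on (\<Union>\<D>) (g ^^ j)" by (rule continuous_on_subset[OF funpow_cont(2) UX])
      show "\<delta> \<le> diameter ((g ^^ j) ` S)" if "S \<in> \<D>" for S
        by (rule not_shrinks_imp_large[OF cont[OF that] order_trans[OF SB[OF that] B(2)] large[OF that]])
    qed
    then have "\<not> shrinks (\<Inter>\<D>)"
      using shrinks_iff_small[OF I order_trans[OF IB B(2)]] by (simp add: not_less)
    then have "\<Inter>\<D> \<in> \<M>" using I IB by (simp add: \<M>_def)
    moreover have "\<Union>\<C> = - \<Inter>\<D>" unfolding \<D>_def by auto
    ultimately show "\<Union>\<C> \<in> uminus ` \<M>" by blast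
  qed
  then obtain M where M: "M \<in> \<M>" and min: "\<And>Y. Y \<in> \<M> \<Longrightarrow> - M \<subseteq> - Y \<Longrightarrow> - Y = - M"
    by (auto simp: image_iff)
  have "\<forall>C. continuum C \<and> C \<subset> M \<longrightarrow> shrinks C"
  proof (intro allI impI, elim conjE, rule ccontr)
    fix C assume C: "continuum C" "C \<subset> M" "\<not> shrinks C"
    then have "C \<in> \<M>" using M by (auto simp: \<M>_def)
    then have "- C = - M" using min[of C] C by auto
    then show False using C by auto
  qed
  then show thesis using that[of M] M by (simp add: \<M>_def)
qed

text \<open>In a minimal non-shrinking continuum \<open>M\<close>, Baire gives a relatively open piece which shrinks.
  The points outside it lie in components reaching its closure, so some of these components stay
  large; a limit of them is a proper subcontinuum of \<open>M\<close> that does not shrink.\<close>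

theorem countable_closed_cover_shrinks:
  assumes B: "continuum B" "B \<subseteq> X"
    and S: "\<And>k. closed (S k)" "\<And>k. S k \<subseteq> X" "\<And>k. shrinks (S k)" "B \<subseteq> (\<Union>k::nat. S k)"
  shows "shrinks B"
proof (rule ccontr)
  assume ns: "\<not> shrinks B"
  obtain M where M: "continuum M" "M \<subseteq> B" "\<not> shrinks M"
    and min: "\<forall>C. continuum C \<and> C \<subset> M \<longrightarrow> shrinks C"
    by (rule minimal_not_shrinking[OF B ns]) (rule that)
  have MX: "M \<subseteq> X" by (rule order_trans[OF M(2) B(2)])
  obtain k W where W: "open W" "M \<inter> W \<noteq> {}" "M \<inter> W \<subseteq> S k"
    using compact_Baire_cover[OF continuum_imp_compact[OF M(1)] continuum_imp_nonempty[OF M(1)]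
        S(1) order_trans[OF M(2) S(4)]] by metis
  have cS: "compact (S k)" using compact_Int_closed[OF compact_X S(1), of k] S(2)[of k] by (simp add: Int_absorb1)
  obtain n0 where n0: "\<And>n. n \<ge> n0 \<Longrightarrow> diameter ((g ^^ n) ` S k) < \<delta> / 4"
    using order_tendstoD(2)[OF S(3)[unfolded shrinks_def, of k], of "\<delta> / 4"] \<delta>_pos
    by (auto simp: eventually_sequentially)
  \<comment> \<open>Otherwise \<open>g ^^ n\<close> would send each point of \<open>M\<close> to
    within \<open>\<delta> / 4\<close> of the image of \<open>S k\<close>, whose diameter is below
    \<open>\<delta> / 4\<close>, and the image of \<open>M\<close> would have diameter below
    \<open>\<delta>\<close>.\<close>
  have "\<exists>K. continuum K \<and> K \<subseteq> M \<inter> - W \<and> \<delta> / 4 \<le> diameter ((g ^^ n) ` K)" if n: "n \<ge> n0" for n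
  proof (rule ccontr)
    assume "\<not> ?thesis"
    then have small: "diameter ((g ^^ n) ` K) < \<delta> / 4" if "continuum K" "K \<subseteq> M \<inter> - W" for K
      using that by (meson not_less)
    have near: "\<exists>y'\<in>S k. dist ((g ^^ n) y) ((g ^^ n) y') < \<delta> / 4" if y: "y \<in> M" for y
    proof (cases "y \<in> W")
      case True
      then show ?thesis using y W \<delta>_pos by (intro bexI[of _ y]) auto
    next
      case False
      then obtain K where K: "continuum K" "K \<subseteq> M \<inter> - W" "y \<in> K" "K \<inter> closure (M - - W) \<noteq> {}"
        using component_meets_closure_complement[OF M(1), of "- W" y] W y by auto
      \<comment> \<open>\<open>M - - W\<close> is \<open>M \<inter> W\<close>; its closure stays in
        the closed set \<open>S k\<close>, so the continuum \<open>K\<close> through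
        \<open>y\<close> reaches \<open>S k\<close>.\<close>
      have "closure (M - - W) \<subseteq> S k"
        using W S(1)[of k] by (intro closure_minimal) auto
      then obtain y' where y': "y' \<in> K" "y' \<in> S k" using K by blast
      have "dist ((g ^^ n) y) ((g ^^ n) y') \<le> diameter ((g ^^ n) ` K)"
        using continuum_funpow_image(3)[of K n] K MX y'
        by (intro dist_le_diameter_compact) (auto simp: continuum_def)
      then show ?thesis using small[OF K(1,2)] y' by force
    qed
    have img: "compact ((g ^^ n) ` M)" "(g ^^ n) ` M \<noteq> {}"
      using continuum_funpow_image(3)[OF M(1) MX, of n] by (auto simp: continuum_def)
    obtain a b where ab: "a \<in> M" "b \<in> M"
      "dist ((g ^^ n) a) ((g ^^ n) b) = diameter ((g ^^ n) ` M)"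
      using diameter_compact_attained[OF img] by auto
    obtain a' b' where a'b': "a' \<in> S k" "dist ((g ^^ n) a) ((g ^^ n) a') < \<delta> / 4"
      "b' \<in> S k" "dist ((g ^^ n) b) ((g ^^ n) b') < \<delta> / 4"
      using near ab by meson
    have "compact ((g ^^ n) ` S k)"
      using cS S(2) funpow_cont(2) by (meson compact_continuous_image continuous_on_subset)
    then have "dist ((g ^^ n) a') ((g ^^ n) b') \<le> diameter ((g ^^ n) ` S k)"
      using a'b' by (intro dist_le_diameter_compact) auto
    moreover have "\<delta> \<le> dist ((g ^^ n) a) ((g ^^ n) b)"
      using not_shrinks_imp_large[OF M(1) MX M(3), of n] ab(3) by simp
    ultimately show False
      using a'b' n0[OF n] \<delta>_pos dist_triangle[of "(g ^^ n) a" "(g ^^ n) b" "(g ^^ n) a'"]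
        dist_triangle[of "(g ^^ n) a'" "(g ^^ n) b" "(g ^^ n) b'"]
        dist_commute[of "(g ^^ n) b" "(g ^^ n) b'"]
      by linarith
  qed
  then have "\<forall>n. \<exists>K. continuum K \<and> K \<subseteq> M \<inter> - W \<and> \<delta> / 4 \<le> diameter ((g ^^ (n0 + n)) ` K)"
    by simp
  from choice[OF this] obtain K where "\<forall>n. continuum (K n) \<and> K n \<subseteq> M \<inter> - W \<and>
      \<delta> / 4 \<le> diameter ((g ^^ (n0 + n)) ` K n)" ..
  then have K: "continuum (K n)" "K n \<subseteq> M \<inter> - W" "\<delta> / 4 \<le> diameter ((g ^^ (n0 + n)) ` K n)" for n
    by simp_all
  \<comment> \<open>The continua \<open>K n\<close> have images of diameter at least
    \<open>\<delta> / 4\<close> at time \<open>n0 + n\<close>. Hence their images at a fixed time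
    \<open>j\<close> have diameter at least \<open>\<delta>\<close> once \<open>n\<close> is large,
    and a limit of them does not shrink.\<close>
  obtain N where N: "\<And>A j n. continuum A \<Longrightarrow> A \<subseteq> X \<Longrightarrow> \<delta> / 4 \<le> diameter ((g ^^ n) ` A) \<Longrightarrow>
      j + N \<le> n \<Longrightarrow> \<delta> \<le> diameter ((g ^^ j) ` A)"
    using diameter_backward[of "\<delta> / 4", OF divide_pos_pos[OF \<delta>_pos]] by fastforce
  have KX: "K n \<subseteq> X" for n using K(2)[of n] MX by blast
  obtain L where L: "continuum L" "L \<subseteq> X" "L \<subseteq> M \<inter> - W" "\<not> shrinks L"
  proof (rule limit_not_shrinks[of K "M \<inter> - W"])
    show "\<forall>\<^sub>F n in sequentially. \<delta> \<le> diameter ((g ^^ j) ` K n)" for j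
      unfolding eventually_sequentially
      using N[OF K(1) KX K(3)] by (intro exI[of _ "j + N"]) auto
    show "closed (M \<inter> - W)"
      by (intro closed_Int compact_imp_closed continuum_imp_compact M closed_Compl W)
  qed (use K KX in auto)
  then have "L \<subset> M" using W(2) by blast
  then show False using min L(1,4) by blast
qed

text \<open>\<open>Vu g H q\<close> is covered by countably many closed sets \<open>S k\<close>,
  where \<open>F k\<close> collects the continua through \<open>q\<close> whose backward images are
  small from time \<open>k\<close> on. Sharing \<open>q\<close>, they have a connected union, whose
  image at time \<open>k\<close> lies within \<open>\<delta> / 3\<close> of the image of
  \<open>q\<close>; a diameter of at most \<open>2 * \<delta> / 3\<close> makes its closure
  shrink.\<close>

lemma subset_Vu_shrinks:
  assumes B: "continuum B" "B \<subseteq> Vu g H q" and H: "compact H" "H \<subseteq> X"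
  shows "shrinks B"
proof -
  define F where "F k = {A \<in> hyperspace_C H. q \<in> A \<and> (\<forall>n\<ge>k. diameter ((g ^^ n) ` A) \<le> \<delta> / 3)}" for k
  define S where "S k = closure (\<Union>(F k))" for k
  have A: "compact A" "A \<subseteq> H" "connected A" if "A \<in> hyperspace_C H" for A
    using that closedin_compact[OF H(1), of A] closedin_imp_subset[of euclidean H A]
    by (simp_all add: hyperspace_C_def)
  have FH: "\<Union>(F k) \<subseteq> H" for k using A(2) by (auto simp: F_def)
  have SH: "S k \<subseteq> H" for k
    unfolding S_def using FH H(1) by (intro closure_minimal compact_imp_closed) auto
  have SX: "S k \<subseteq> X" for k using SH H(2) by blast
  have sh: "shrinks (S k)" for k
  proof (cases "F k = {}")
    case True
    then show ?thesis by (simp add: S_def shrinks_def)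
  next
    case False
    then have "q \<in> \<Union>(F k)" by (auto simp: F_def)
    have "connected (\<Union>(F k))"
      by (rule connected_Union) (use False A(3) in \<open>auto simp: F_def\<close>)
    then have "connected (S k)" unfolding S_def by (rule connected_imp_connected_closure)
    moreover have "compact (S k)"
      using compact_Int_closed[OF H(1), of "S k"] SH[of k] by (simp add: S_def Int_absorb1)
    moreover have "q \<in> S k"
      using subsetD[OF closure_subset \<open>q \<in> \<Union>(F k)\<close>] by (simp add: S_def)
    ultimately have cont: "continuum (S k)" by (auto simp: continuum_def)
    have *: "dist ((g ^^ k) x) ((g ^^ k) q) \<le> \<delta> / 3" if "x \<in> S k" for x
    proof -
      have "(g ^^ k) ` closure (\<Union>(F k)) \<subseteq> cball ((g ^^ k) q) (\<delta> / 3)"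
      proof (rule image_closure_subset)
        show "continuous_on (closure (\<Union>(F k))) (g ^^ k)"
          using continuous_on_subset[OF funpow_cont(2) SX] by (simp add: S_def)
        show "(g ^^ k) ` \<Union>(F k) \<subseteq> cball ((g ^^ k) q) (\<delta> / 3)"
        proof clarify
          fix y A assume y: "y \<in> A" "A \<in> F k"
          then have "A \<in> hyperspace_C H" "q \<in> A" "diameter ((g ^^ k) ` A) \<le> \<delta> / 3"
            by (auto simp: F_def)
          moreover have "compact ((g ^^ k) ` A)"
            using A(1,2)[OF \<open>A \<in> hyperspace_C H\<close>] H(2)
            by (intro compact_continuous_image continuous_on_subset[OF funpow_cont(2)]) auto
          ultimately show "(g ^^ k) y \<in> cball ((g ^^ k) q) (\<delta> / 3)"
            using dist_le_diameter_compact[of "(g ^^ k) ` A" "(g ^^ k) q" "(g ^^ k) y"] y by auto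
        qed
      qed simp
      then show ?thesis using that by (auto simp: S_def dist_commute)
    qed
    have "diameter ((g ^^ k) ` S k) \<le> 2 * \<delta> / 3"
    proof (rule diameter_leI)
      fix u v assume "u \<in> (g ^^ k) ` S k" "v \<in> (g ^^ k) ` S k"
      then obtain x y where "x \<in> S k" "y \<in> S k" "u = (g ^^ k) x" "v = (g ^^ k) y" by blast
      then show "dist u v \<le> 2 * \<delta> / 3"
        using *[of x] *[of y] dist_triangle2[of u v "(g ^^ k) q"] by auto
    qed (use \<open>q \<in> S k\<close> in auto)
    then have "diameter ((g ^^ k) ` S k) < \<delta>" using \<delta>_pos by simp
    then show ?thesis using shrinks_iff_small[OF cont SX] by blast
  qed
  have "B \<subseteq> (\<Union>k. S k)"
  proof
    fix y assume "y \<in> B"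
    then obtain A where A': "A \<in> hyperspace_C H" "q \<in> A" "y \<in> A"
      "(\<lambda>n. diameter ((g ^^ n) ` A)) \<longlonglongrightarrow> 0" using B(2) by (auto simp: Vu_def)
    then have "\<forall>\<^sub>F n in sequentially. diameter ((g ^^ n) ` A) < \<delta> / 3"
      using order_tendstoD(2) \<delta>_pos by (metis divide_pos_pos zero_less_numeral)
    then obtain k where "\<And>n. n \<ge> k \<Longrightarrow> diameter ((g ^^ n) ` A) < \<delta> / 3"
      by (auto simp: eventually_sequentially)
    then have "A \<in> F k" using A' by (auto simp: F_def less_imp_le)
    then have "y \<in> \<Union>(F k)" using A'(3) by blast
    then have "y \<in> S k" using closure_subset[of "\<Union>(F k)"] by (auto simp: S_def)
    then show "y \<in> (\<Union>k. S k)" by blast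
  qed
  moreover have "B \<subseteq> X" using B(2) H(2) by (auto simp: Vu_def)
  moreover have "closed (S k)" for k by (simp add: S_def)
  ultimately show ?thesis
    by (intro countable_closed_cover_shrinks[OF B(1), of S] sh SX)
qed

end

section \<open>Spreading of subcontinua and independence\<close>

text \<open>At least \<open>n div M\<close> multiples of \<open>M\<close> lie in
  \<open>{1..n}\<close>; for \<open>n \<ge> 2 * M\<close> rounding costs at most half of the density
  \<open>1 / M\<close>.\<close>

lemma positive_density_multiples:
  assumes "M \<ge> 1"
  shows "positive_density {i. 1 \<le> i \<and> M dvd i}"
proof -
  let ?I = "{i. 1 \<le> i \<and> M dvd i}"
  have "ereal (1 / (2 * real M)) \<le> liminf (\<lambda>n. ereal (real (card (?I \<inter> {1..n})) / real n))"
  proof (rule Liminf_bounded, unfold eventually_sequentially, intro exI[of _ "2 * M"] allI impI)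
    fix n assume n: "2 * M \<le> n"
    have "(\<lambda>k. M * k) ` {1..n div M} \<subseteq> ?I \<inter> {1..n}"
    proof
      fix i assume "i \<in> (\<lambda>k. M * k) ` {1..n div M}"
      then obtain k where "i = M * k" "k \<in> {1..n div M}" by blast
      then have k: "i = M * k" "1 \<le> k" "k \<le> n div M" by simp_all
      then have "M * k \<le> M * (n div M)" by (intro mult_left_mono) auto
      then have "M * k \<le> n" by (rule order_trans) simp
      then show "i \<in> ?I \<inter> {1..n}" using k assms by simp
    qed
    moreover have "inj_on (\<lambda>k. M * k) {1..n div M}" using assms by (auto simp: inj_on_def)
    ultimately have "n div M \<le> card (?I \<inter> {1..n})"
      using card_mono[of "?I \<inter> {1..n}" "(\<lambda>k. M * k) ` {1..n div M}"] by (simp add: card_image)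
    moreover have "real n < real M * (real (n div M) + 1)"
    proof -
      have "n < M * (n div M + 1)"
        using assms dividend_less_times_div[of M n] by simp
      then have "real n < real (M * (n div M + 1))" by (simp only: of_nat_less_iff)
      then show ?thesis by (simp add: algebra_simps)
    qed
    ultimately have "real n < real M * (real (card (?I \<inter> {1..n})) + 1)"
      using assms by (smt (verit) mult_left_mono of_nat_0_le_iff of_nat_le_iff)
    moreover have "2 * real M \<le> real n" using n by linarith
    ultimately have "real n \<le> 2 * real M * real (card (?I \<inter> {1..n}))"
      by (simp add: algebra_simps)
    then show "ereal (1 / (2 * real M)) \<le> ereal (real (card (?I \<inter> {1..n})) / real n)"
      using assms n by (simp add: field_simps)
  qed
  moreover have "0 < ereal (1 / (2 * real M))" using assms by simp
  ultimately show ?thesis unfolding positive_density_def by (rule less_le_trans[rotated])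
qed

text \<open>By boundary bumping, a continuum through \<open>x\<close> inside the closed ball
  contains a point at distance at least \<open>r\<close> from \<open>p\<close>, while
  \<open>x\<close> is closer to \<open>p\<close> than \<open>r / 2\<close>.\<close>

lemma subcontinuum_in_cball:
  fixes A :: "'a::metric_space set"
  assumes A: "continuum A" "\<not> A \<subseteq> cball p r" and x: "x \<in> A" "dist p x < r / 2"
  obtains C where "continuum C" "C \<subseteq> A \<inter> cball p r" "r / 2 \<le> diameter C"
proof -
  have "r > 0" using x(2) zero_le_dist[of p x] by linarith
  then have xT: "x \<in> cball p r" using x(2) by simp
  obtain C where C: "continuum C" "C \<subseteq> A \<inter> cball p r" "x \<in> C" "C \<inter> closure (A - cball p r) \<noteq> {}"
    using component_meets_closure_complement[OF A(1) closed_cball A(2) x(1) xT] by blast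
  have "closure (A - cball p r) \<subseteq> - ball p r"
    by (intro closure_minimal) (auto simp: closed_Compl)
  then obtain y where y: "y \<in> C" "r \<le> dist p y" using C(4) by fastforce
  have "r / 2 \<le> dist x y" using y(2) x(2) dist_triangle[of p y x] by linarith
  also have "\<dots> \<le> diameter C"
    using C(1,3) y(1) by (intro dist_le_diameter_compact continuum_imp_compact)
  finally show thesis using that C by blast
qed

section \<open>Spreading of subcontinua over the periodic continuum \<open>H\<close>\<close>

locale mixing_subcontinuum = expanding_homeo +
  fixes H :: "'a set" and m :: nat
  assumes H: "continuum H" "H \<subseteq> X" "nondegenerate H"
    and m: "m \<ge> 1" "(f ^^ m) ` H = H"
    and proper_shrinks: "\<And>B. continuum B \<Longrightarrow> B \<subset> H \<Longrightarrow> shrinks B"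
begin

lemma funpow_image_H: "(f ^^ (m * n)) ` H = H" "(g ^^ (m * n)) ` H = H"
proof -
  show *: "(f ^^ (m * n)) ` H = H"
  proof (induction n)
    case (Suc n)
    have "(f ^^ (m * Suc n)) ` H = (f ^^ m) ` (f ^^ (m * n)) ` H"
      by (simp add: funpow_add image_comp)
    then show ?case using Suc m by simp
  qed simp
  have "(g ^^ (m * n)) ` H = (g ^^ (m * n)) ` (f ^^ (m * n)) ` H" using * by simp
  also have "\<dots> = H"
  proof -
    have "(g ^^ (m * n)) ((f ^^ (m * n)) x) = x" if "x \<in> H" for x
      using that H(2) funpow_cancel(1)[of x "m * n" "m * n"] by auto
    then show ?thesis by (simp add: image_image)
  qed
  finally show "(g ^^ (m * n)) ` H = H" .
qed

text \<open>Otherwise late images missing \<open>U\<close> would accumulate at a continuum in the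
  closed set \<open>H - U\<close>. It would be proper, hence shrinking; but \<open>j\<close> steps
  back from a late image there is still a late image of a continuum of diameter at least
  \<open>\<gamma>\<close>, so the limit cannot shrink.\<close>

lemma subcontinua_spread:
  assumes \<gamma>: "\<gamma> > 0" and U: "openin (top_of_set H) U" "U \<noteq> {}"
  shows "\<forall>\<^sub>F n in sequentially. \<forall>A. continuum A \<and> A \<subseteq> H \<and> \<gamma> \<le> diameter A \<longrightarrow>
    (f ^^ (m * n)) ` A \<inter> U \<noteq> {}"
proof (rule ccontr)
  assume "\<not> ?thesis"
  then have "\<forall>N. \<exists>n A. N \<le> n \<and> continuum A \<and> A \<subseteq> H \<and> \<gamma> \<le> diameter A \<and> (f ^^ (m * n)) ` A \<inter> U = {}"
    unfolding eventually_sequentially by blast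
  from choice[OF this] obtain r where "\<forall>N. \<exists>A. N \<le> r N \<and> continuum A \<and> A \<subseteq> H \<and> \<gamma> \<le> diameter A \<and>
      (f ^^ (m * r N)) ` A \<inter> U = {}" ..
  from choice[OF this] obtain A where "\<forall>N. N \<le> r N \<and> continuum (A N) \<and> A N \<subseteq> H \<and>
      \<gamma> \<le> diameter (A N) \<and> (f ^^ (m * r N)) ` A N \<inter> U = {}" ..
  then have A: "N \<le> r N" "continuum (A N)" "A N \<subseteq> H" "\<gamma> \<le> diameter (A N)"
    "(f ^^ (m * r N)) ` A N \<inter> U = {}" for N by simp_all
  define K where "K N = (f ^^ (m * r N)) ` A N" for N
  have AX: "A N \<subseteq> X" for N using A(3)[of N] H(2) by blast
  have K: "continuum (K N)" "K N \<subseteq> X" for N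
    using continuum_funpow_image[OF A(2) AX] by (auto simp: K_def)
  have KH: "K N \<subseteq> H - U" for N
    using A(3,5)[of N] funpow_image_H(1)[of "r N"] by (auto simp: K_def)
  obtain N0 where N0: "\<forall>A n. continuum A \<and> A \<subseteq> X \<and> \<gamma> \<le> diameter A \<and> N0 \<le> n \<longrightarrow>
      \<delta> \<le> diameter ((f ^^ n) ` A)"
    using expanding[OF \<gamma>] ..
  obtain L where L: "continuum L" "L \<subseteq> X" "L \<subseteq> H - U" "\<not> shrinks L"
  proof (rule limit_not_shrinks[of K "H - U"])
    show "\<forall>\<^sub>F N in sequentially. \<delta> \<le> diameter ((g ^^ j) ` K N)" for j
      unfolding eventually_sequentially
    proof (intro exI[of _ "j + N0"] allI impI)
      fix N assume N: "j + N0 \<le> N"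
      \<comment> \<open>Since \<open>m \<ge> 1\<close>, the exponent \<open>m * r N\<close> is at
        least \<open>N\<close>, so \<open>j\<close> backward steps leave at least \<open>N0\<close>
        forward ones.\<close>
      have "N \<le> m * r N" using A(1)[of N] m(1) by (metis le_trans mult_le_mono mult_1)
      then have le: "j + N0 \<le> m * r N" using N by linarith
      have "(g ^^ j) ` K N = (f ^^ (m * r N - j)) ` A N"
        unfolding K_def image_image using le AX[of N]
        by (intro image_cong funpow_cancel) auto
      then show "\<delta> \<le> diameter ((g ^^ j) ` K N)"
        using N0 A(2,4)[of N] AX[of N] le by simp
    qed
    have "closedin (top_of_set H) (H - U)" using U(1) by (simp add: closedin_diff)
    then show "closed (H - U)"
      using closedin_compact[OF continuum_imp_compact[OF H(1)]] compact_imp_closed by blast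
  qed (use K KH in auto)
  have "U \<subseteq> H" using U(1) openin_imp_subset by blast
  then have "L \<subset> H" using L(3) U(2) by blast
  then show False using proper_shrinks L by blast
qed

text \<open>A late image meets both a ball of radius \<open>r / 2\<close> and the complement of the
  concentric closed ball of radius \<open>r\<close>, so it contains a continuum inside
  \<open>U\<close> of diameter at least \<open>r / 2\<close>. The point is that
  \<open>\<eta>\<close> depends on \<open>U\<close> and not on \<open>\<gamma>\<close>, which allows
  iteration.\<close>

lemma subcontinua_spread_into:
  assumes U: "openin (top_of_set H) U" "U \<noteq> {}"
  shows "\<exists>\<eta>>0. \<forall>\<gamma>>0. \<forall>\<^sub>F n in sequentially. \<forall>A. continuum A \<and> A \<subseteq> H \<and> \<gamma> \<le> diameter A \<longrightarrow>
    (\<exists>C. continuum C \<and> C \<subseteq> (f ^^ (m * n)) ` A \<inter> U \<and> \<eta> \<le> diameter C)"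
proof -
  obtain p where p: "p \<in> U" using U(2) by blast
  obtain W where W: "open W" "U = H \<inter> W" using U(1) by (auto simp: openin_open)
  obtain r0 where r0: "r0 > 0" "ball p r0 \<subseteq> W"
    using W p by (meson IntD2 open_contains_ball)
  have pH: "p \<in> H" using p W by blast
  obtain q where q: "q \<in> H" "q \<noteq> p" using H(3) by (auto simp: nondegenerate_def)
  \<comment> \<open>Below \<open>r0\<close>, the closed ball stays in \<open>W\<close>; below
    \<open>dist p q\<close>, it omits \<open>q\<close>, so that its complement meets
    \<open>H\<close>.\<close>
  define r where "r = min (r0 / 2) (dist p q / 2)"
  have r: "r > 0" "r < r0" "r < dist p q" using r0(1) q(2) by (auto simp: r_def min_def)
  have sub: "H \<inter> cball p r \<subseteq> U" using W r0(2) r(2) by auto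
  have "\<forall>\<^sub>F n in sequentially. \<forall>A. continuum A \<and> A \<subseteq> H \<and> \<gamma> \<le> diameter A \<longrightarrow>
    (\<exists>C. continuum C \<and> C \<subseteq> (f ^^ (m * n)) ` A \<inter> U \<and> r / 2 \<le> diameter C)" if \<gamma>: "\<gamma> > 0" for \<gamma>
  proof -
    have 1: "openin (top_of_set H) (H \<inter> ball p (r / 2))" "H \<inter> ball p (r / 2) \<noteq> {}"
      using pH r(1) by (auto simp: openin_open_Int)
    have 2: "openin (top_of_set H) (H \<inter> - cball p r)" "H \<inter> - cball p r \<noteq> {}"
      using q(1) r(3) by (auto simp: openin_open_Int open_Compl)
    show ?thesis
      using subcontinua_spread[OF \<gamma> 1] subcontinua_spread[OF \<gamma> 2]
    proof eventually_elim
      case (elim n)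
      show ?case
      proof (intro allI impI, elim conjE)
        fix A assume A: "continuum A" "A \<subseteq> H" "\<gamma> \<le> diameter A"
        let ?B = "(f ^^ (m * n)) ` A"
        have B: "continuum ?B" using continuum_funpow_image(1)[OF A(1)] A(2) H(2) by blast
        have BH: "?B \<subseteq> H" using image_mono[OF A(2), of "f ^^ (m * n)"] funpow_image_H(1)[of n] by simp
        have "?B \<inter> (H \<inter> ball p (r / 2)) \<noteq> {}" by (rule elim(1)[rule_format]) (intro conjI A)
        then obtain x where "x \<in> ?B" "x \<in> ball p (r / 2)" by blast
        then have x: "x \<in> ?B" "dist p x < r / 2" by simp_all
        have "?B \<inter> (H \<inter> - cball p r) \<noteq> {}" by (rule elim(2)[rule_format]) (intro conjI A)
        then have "\<not> ?B \<subseteq> cball p r" by blast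
        from subcontinuum_in_cball[OF B this x] obtain C where
          "continuum C" "C \<subseteq> ?B \<inter> cball p r" "r / 2 \<le> diameter C" .
        then show "\<exists>C. continuum C \<and> C \<subseteq> ?B \<inter> U \<and> r / 2 \<le> diameter C"
          using BH sub by blast
      qed
    qed
  qed
  then show ?thesis using r(1) half_gt_zero by blast
qed

lemma diameter_H_pos: "diameter H > 0"
  using H nondegenerate_iff_diameter_pos by (auto simp: continuum_def)

text \<open>The same \<open>\<gamma>\<close> is the size demanded of \<open>A\<close> and the size
  delivered for \<open>C\<close>, so the step can be repeated. Finiteness of \<open>\<U>\<close>
  yields one \<open>\<gamma>\<close> and one time \<open>M\<close> for all its members.\<close>

lemma horseshoe:
  assumes fin: "finite \<U>" and \<U>: "\<And>U. U \<in> \<U> \<Longrightarrow> openin (top_of_set H) U \<and> U \<noteq> {}"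
  obtains \<gamma> M where "0 < \<gamma>" "\<gamma> \<le> diameter H" "M \<ge> (1::nat)"
    "\<forall>U\<in>\<U>. \<forall>A. continuum A \<and> A \<subseteq> H \<and> \<gamma> \<le> diameter A \<longrightarrow>
      (\<exists>C. continuum C \<and> C \<subseteq> (f ^^ M) ` A \<inter> U \<and> \<gamma> \<le> diameter C)"
    "(f ^^ M) ` H = H"
proof -
  have "\<forall>U\<in>\<U>. \<exists>\<eta>>0. \<forall>\<gamma>>0. \<forall>\<^sub>F n in sequentially. \<forall>A. continuum A \<and> A \<subseteq> H \<and> \<gamma> \<le> diameter A \<longrightarrow>
    (\<exists>C. continuum C \<and> C \<subseteq> (f ^^ (m * n)) ` A \<inter> U \<and> \<eta> \<le> diameter C)"
    using subcontinua_spread_into \<U> by blast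
  from bchoice[OF this] obtain \<eta> where \<eta>: "\<forall>U\<in>\<U>. \<eta> U > 0 \<and> (\<forall>\<gamma>>0. \<forall>\<^sub>F n in sequentially.
    \<forall>A. continuum A \<and> A \<subseteq> H \<and> \<gamma> \<le> diameter A \<longrightarrow>
    (\<exists>C. continuum C \<and> C \<subseteq> (f ^^ (m * n)) ` A \<inter> U \<and> \<eta> U \<le> diameter C))" ..
  \<comment> \<open>Including \<open>diameter H\<close> in the minimum lets \<open>H\<close> itself
    start the iteration.\<close>
  define \<gamma> where "\<gamma> = Min (insert (diameter H) (\<eta> ` \<U>))"
  have \<gamma>: "0 < \<gamma>" "\<gamma> \<le> diameter H" "\<And>U. U \<in> \<U> \<Longrightarrow> \<gamma> \<le> \<eta> U"
    using fin \<eta> diameter_H_pos by (auto simp: \<gamma>_def)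
  have "\<forall>\<^sub>F n in sequentially. \<forall>U\<in>\<U>. \<forall>A. continuum A \<and> A \<subseteq> H \<and> \<gamma> \<le> diameter A \<longrightarrow>
    (\<exists>C. continuum C \<and> C \<subseteq> (f ^^ (m * n)) ` A \<inter> U \<and> \<eta> U \<le> diameter C)"
    using \<eta> \<gamma>(1) by (intro eventually_ball_finite fin) blast
  then obtain N where N: "\<forall>n\<ge>N. \<forall>U\<in>\<U>. \<forall>A. continuum A \<and> A \<subseteq> H \<and> \<gamma> \<le> diameter A \<longrightarrow>
    (\<exists>C. continuum C \<and> C \<subseteq> (f ^^ (m * n)) ` A \<inter> U \<and> \<eta> U \<le> diameter C)"
    unfolding eventually_sequentially by (elim exE)
  show thesis
  \<comment> \<open>\<open>Suc N\<close> instead of \<open>N\<close> ensures a positive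
    time.\<close>
  proof (rule that[OF \<gamma>(1,2), of "m * Suc N"])
    show "1 \<le> m * Suc N" using m(1) by simp
    show "(f ^^ (m * Suc N)) ` H = H" by (rule funpow_image_H(1))
    show "\<forall>U\<in>\<U>. \<forall>A. continuum A \<and> A \<subseteq> H \<and> \<gamma> \<le> diameter A \<longrightarrow>
      (\<exists>C. continuum C \<and> C \<subseteq> (f ^^ (m * Suc N)) ` A \<inter> U \<and> \<gamma> \<le> diameter C)"
    proof (intro ballI allI impI)
      fix U A assume U: "U \<in> \<U>" and A: "continuum A \<and> A \<subseteq> H \<and> \<gamma> \<le> diameter A"
      have "N \<le> Suc N" by simp
      with N U A obtain C where "continuum C" "C \<subseteq> (f ^^ (m * Suc N)) ` A \<inter> U" "\<eta> U \<le> diameter C"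
        by metis
      then show "\<exists>C. continuum C \<and> C \<subseteq> (f ^^ (m * Suc N)) ` A \<inter> U \<and> \<gamma> \<le> diameter C"
        using \<gamma>(3)[OF U] order_trans by blast
    qed
  qed
qed

text \<open>Itineraries grow at the front: a continuum for the shifted sequence is moved forward by
  \<open>f ^^ M\<close>, which makes its history one step longer, and cut down to
  \<open>U 0\<close>. Retaining diameter \<open>\<gamma>\<close> keeps the induction going.\<close>

lemma backward_itinerary:
  assumes \<gamma>: "\<gamma> \<le> diameter H" and M: "(f ^^ M) ` H = H"
    and shoe: "\<forall>U\<in>\<U>. \<forall>A. continuum A \<and> A \<subseteq> H \<and> \<gamma> \<le> diameter A \<longrightarrow>
      (\<exists>C. continuum C \<and> C \<subseteq> (f ^^ M) ` A \<inter> U \<and> \<gamma> \<le> diameter C)"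
    and U: "\<And>k. k < l \<Longrightarrow> U k \<in> \<U>"
  shows "\<exists>C. continuum C \<and> C \<subseteq> H \<and> \<gamma> \<le> diameter C \<and> (\<forall>k<l. (g ^^ (M * k)) ` C \<subseteq> U k)"
  using U
proof (induction l arbitrary: U)
  case 0
  then show ?case using H(1) \<gamma> by auto
next
  case (Suc l)
  have "\<exists>C. continuum C \<and> C \<subseteq> H \<and> \<gamma> \<le> diameter C \<and> (\<forall>k<l. (g ^^ (M * k)) ` C \<subseteq> U (Suc k))"
    using Suc.prems by (intro Suc.IH) auto
  then obtain C where C: "continuum C" "C \<subseteq> H" "\<gamma> \<le> diameter C"
    "\<And>k. k < l \<Longrightarrow> (g ^^ (M * k)) ` C \<subseteq> U (Suc k)" by blast
  have "U 0 \<in> \<U>" using Suc.prems by simp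
  then obtain C' where C': "continuum C'" "C' \<subseteq> (f ^^ M) ` C \<inter> U 0" "\<gamma> \<le> diameter C'"
    using shoe C(1-3) by blast
  have "C' \<subseteq> H" using C'(2) image_mono[OF C(2), of "f ^^ M"] M by blast
  moreover have "(g ^^ (M * k)) ` C' \<subseteq> U k" if "k < Suc l" for k
  proof (cases k)
    case 0
    then show ?thesis using C'(2) by auto
  next
    case (Suc j)
    show ?thesis
    proof clarify
      fix x assume "x \<in> C'"
      then obtain y where y: "y \<in> C" "x = (f ^^ M) y" using C'(2) by blast
      then have "(g ^^ M) x = y" using funpow_cancel(1)[of y M M] C(2) H(2) by auto
      moreover have "(g ^^ (M * k)) x = (g ^^ (M * j)) ((g ^^ M) x)"
        unfolding Suc using funpow_add[of "M * j" M g] by (simp add: add.commute)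
      ultimately have "(g ^^ (M * k)) x = (g ^^ (M * j)) y" by simp
      then show "(g ^^ (M * k)) x \<in> U k" using C(4)[of j] y(1) that Suc by auto
    qed
  qed
  ultimately show ?case using C'(1,3) by blast
qed

text \<open>Times are restricted to multiples of the horseshoe time \<open>M\<close>, along which
  every finite itinerary is realised; these have positive density.\<close>

lemma independence_of_open_sets:
  assumes fin: "finite \<A>" "\<A> \<noteq> {}"
    and \<A>: "\<And>A. A \<in> \<A> \<Longrightarrow> openin (top_of_set X) A \<and> A \<inter> H \<noteq> {}"
  shows "has_independence_set_pos_density X g \<A>"
proof -
  define \<U> where "\<U> = (\<lambda>A. H \<inter> A) ` \<A>"
  have fU: "finite \<U>" using fin by (simp add: \<U>_def)
  have oU: "openin (top_of_set H) U \<and> U \<noteq> {}" if U: "U \<in> \<U>" for U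
  proof -
    obtain A where A: "A \<in> \<A>" "U = H \<inter> A" using U unfolding \<U>_def by blast
    obtain W where "open W" "A = X \<inter> W" using \<A>[OF A(1)] by (auto simp: openin_open)
    then have "U = H \<inter> W" using A(2) H(2) by blast
    then show ?thesis using \<open>open W\<close> \<A>[OF A(1)] A(2) by (auto simp: openin_open)
  qed
  obtain \<gamma> M where \<gamma>: "0 < \<gamma>" "\<gamma> \<le> diameter H" and M: "M \<ge> (1::nat)"
    and shoe: "\<forall>U\<in>\<U>. \<forall>A. continuum A \<and> A \<subseteq> H \<and> \<gamma> \<le> diameter A \<longrightarrow>
      (\<exists>C. continuum C \<and> C \<subseteq> (f ^^ M) ` A \<inter> U \<and> \<gamma> \<le> diameter C)"
    and MH: "(f ^^ M) ` H = H"
    by (rule horseshoe[OF fU oU], assumption, rule that)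
  let ?I = "{i. 1 \<le> i \<and> M dvd i}"
  show ?thesis
    unfolding has_independence_set_pos_density_def
  proof (intro exI[of _ ?I] conjI allI impI)
    show "positive_density ?I" by (rule positive_density_multiples[OF M])
    fix J :: "nat set" and Y :: "nat \<Rightarrow> 'a set"
    assume "finite J \<and> J \<subseteq> ?I \<and> (\<forall>j\<in>J. Y j \<in> \<A>)"
    then have J: "finite J" "J \<subseteq> ?I" "\<forall>j\<in>J. Y j \<in> \<A>" by simp_all
    obtain A0 where A0: "A0 \<in> \<A>" using fin by blast
    \<comment> \<open>At times outside \<open>J\<close> the itinerary is irrelevant; \<open>A0\<close> is a filler.\<close>
    define U where "U k = (if M * k \<in> J then H \<inter> Y (M * k) else H \<inter> A0)" for k
    have "U k \<in> \<U>" for k using J(3) A0 by (auto simp: U_def \<U>_def)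
    \<comment> \<open>\<open>insert 0 J\<close> covers the case \<open>J = {}\<close>. Since
      \<open>k \<le> M * k\<close>, a length just above the maximum reaches every index
      \<open>k\<close> with \<open>M * k \<in> J\<close>.\<close>
    then obtain C where C: "continuum C" "C \<subseteq> H"
      "\<forall>k<Suc (Max (insert 0 J)). (g ^^ (M * k)) ` C \<subseteq> U k"
      using backward_itinerary[OF \<gamma>(2) MH shoe, of "Suc (Max (insert 0 J))" U] by blast
    obtain x where x: "x \<in> C" using continuum_imp_nonempty[OF C(1)] by blast
    have "(g ^^ j) x \<in> Y j" if j: "j \<in> J" for j
    proof -
      obtain k where k: "j = M * k" using J(2) j by auto
      have "k \<le> j" using k M by simp
      also have "j \<le> Max (insert 0 J)" using J(1) j by simp
      finally have "(g ^^ (M * k)) ` C \<subseteq> U k" using C(3) by simp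
      then show ?thesis using x k j by (auto simp: U_def)
    qed
    then have "x \<in> X \<inter> (\<Inter>j\<in>J. (g ^^ j) -` Y j)" using x C(2) H(2) by auto
    then show "X \<inter> (\<Inter>j\<in>J. (g ^^ j) -` Y j) \<noteq> {}" by blast
  qed auto
qed

text \<open>Neighbourhoods of points of \<open>H\<close> are open sets meeting \<open>H\<close>, so
  independence holds for all tuples in \<open>H\<close>, and in particular for those in the Cantor
  set.\<close>

lemma IE_tuple_in_H:
  assumes "xs \<noteq> []" "set xs \<subseteq> H"
  shows "IE_tuple X g xs"
  unfolding IE_tuple_def
proof (intro conjI allI impI)
  fix As
  assume "length As = length xs \<and>
    (\<forall>i<length xs. openin (top_of_set X) (As ! i) \<and> xs ! i \<in> As ! i)"
  then have As: "length As = length xs"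
    "\<forall>i<length xs. openin (top_of_set X) (As ! i) \<and> xs ! i \<in> As ! i" by simp_all
  show "has_independence_set_pos_density X g (set As)"
  proof (rule independence_of_open_sets)
    show "set As \<noteq> {}" using As(1) assms(1) by auto
    fix A assume "A \<in> set As"
    then obtain i where i: "i < length xs" "A = As ! i" using As(1) by (auto simp: in_set_conv_nth)
    then have "xs ! i \<in> A \<inter> H" using As(2) assms(2) by auto
    then show "openin (top_of_set X) A \<and> A \<inter> H \<noteq> {}" using As(2) i by auto
  qed simp
qed (use assms H(2) in auto)

end

section \<open>The Cantor scheme\<close>

lemma liminf_eq_0I:
  fixes h :: "nat \<Rightarrow> real"
  assumes "\<And>n. 0 \<le> h n" "\<And>e N. e > 0 \<Longrightarrow> \<exists>n\<ge>N. h n < e"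
  shows "liminf (\<lambda>n. ereal (h n)) = 0"
proof (rule antisym)
  show "0 \<le> liminf (\<lambda>n. ereal (h n))"
    using assms(1) by (intro Liminf_bounded always_eventually) auto
  show "liminf (\<lambda>n. ereal (h n)) \<le> 0"
  proof (rule ccontr)
    assume "\<not> ?thesis"
    then have "0 < liminf (\<lambda>n. ereal (h n))" by simp
    then obtain e where e: "0 < ereal e" "ereal e < liminf (\<lambda>n. ereal (h n))"
      using ereal_dense2 by blast
    then obtain N where "\<And>n. n \<ge> N \<Longrightarrow> e < h n"
      using less_LiminfD[OF e(2)] by (auto simp: eventually_sequentially)
    moreover obtain n where "n \<ge> N" "h n < e" using assms(2)[of e N] e(1) by auto
    ultimately show False by (meson less_asym)
  qed
qed

lemma compact_UNIV_nat_bool: "compact (UNIV :: (nat \<Rightarrow> bool) set)"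
proof -
  have "compact (UNIV :: bool set)" by (rule finite_imp_compact) simp
  then have "compact_space (product_topology (\<lambda>i::nat. euclidean :: bool topology) UNIV)"
    by (subst compact_space_product_topology) (simp add: compact_space_def)
  then show ?thesis by (simp add: euclidean_product_topology compact_space_def)
qed

lemma open_agree_upto: "open {\<beta> :: nat \<Rightarrow> bool. \<forall>i<k. \<beta> i = \<alpha> i}"
proof -
  have "open {\<beta> :: nat \<Rightarrow> bool. \<forall>i\<in>{..<k}. \<beta> i \<in> {\<alpha> i}}"
    by (rule product_topology_basis') (auto simp: open_discrete)
  then show ?thesis by (simp add: Ball_def)
qed

text \<open>The initial segment of a binary sequence serves as the address of its cell at level
  \<open>k\<close> of the Cantor scheme.\<close>

definition code :: "(nat \<Rightarrow> 'b) \<Rightarrow> nat \<Rightarrow> 'b list" where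
  "code \<alpha> k = map \<alpha> [0..<k]"

lemma length_code [simp]: "length (code \<alpha> k) = k"
  by (simp add: code_def)

lemma code_Suc: "code \<alpha> (Suc k) = code \<alpha> k @ [\<alpha> k]"
  by (simp add: code_def)

lemma code_eq_iff: "code \<alpha> k = code \<beta> k \<longleftrightarrow> (\<forall>i<k. \<alpha> i = \<beta> i)"
  by (auto simp: code_def)

section \<open>Mixing on \<open>H\<close> and the refinement of cells\<close>

context mixing_subcontinuum
begin

text \<open>Mixing: a nondegenerate continuum inside \<open>V t\<close> has images under
  \<open>f ^^ (m * n)\<close> that meet \<open>E t\<close> for all large \<open>n\<close>, so one
  time serves the finitely many \<open>t\<close>. The set \<open>E' t\<close> consists of the points
  of \<open>E t\<close> which the same power of \<open>g\<close> sends into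
  \<open>V t\<close>.\<close>

lemma shrink_open_family:
  assumes T: "finite T"
    and E: "\<And>t. t \<in> T \<Longrightarrow> openin (top_of_set H) (E t) \<and> E t \<noteq> {}"
    and V: "\<And>t. t \<in> T \<Longrightarrow> openin (top_of_set H) (V t) \<and> V t \<noteq> {}"
  shows "\<exists>n\<ge>k. \<exists>E'. \<forall>t\<in>T. openin (top_of_set H) (E' t) \<and> E' t \<noteq> {} \<and> E' t \<subseteq> E t \<and>
    (g ^^ n) ` E' t \<subseteq> V t"
proof -
  have sub: "\<exists>A. continuum A \<and> A \<subseteq> V t \<and> 0 < diameter A" if t: "t \<in> T" for t
  proof -
    obtain \<eta> where \<eta>: "\<eta> > 0" "\<forall>\<gamma>>0. \<forall>\<^sub>F n in sequentially. \<forall>A. continuum A \<and> A \<subseteq> H \<and>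
      \<gamma> \<le> diameter A \<longrightarrow> (\<exists>C. continuum C \<and> C \<subseteq> (f ^^ (m * n)) ` A \<inter> V t \<and> \<eta> \<le> diameter C)"
      using subcontinua_spread_into[of "V t"] V[OF t] by blast
    \<comment> \<open>The continuum inside \<open>V t\<close> is cut out of an image of
      \<open>H\<close> itself, for which \<open>\<gamma> = diameter H\<close> is admissible.\<close>
    have "\<forall>\<^sub>F n in sequentially. \<forall>A. continuum A \<and> A \<subseteq> H \<and>
      diameter H \<le> diameter A \<longrightarrow> (\<exists>C. continuum C \<and> C \<subseteq> (f ^^ (m * n)) ` A \<inter> V t \<and> \<eta> \<le> diameter C)"
      using \<eta>(2) diameter_H_pos by blast
    from eventually_happens'[OF sequentially_bot this]
    obtain n where "\<forall>A. continuum A \<and> A \<subseteq> H \<and>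
      diameter H \<le> diameter A \<longrightarrow> (\<exists>C. continuum C \<and> C \<subseteq> (f ^^ (m * n)) ` A \<inter> V t \<and> \<eta> \<le> diameter C)" ..
    then obtain C where "continuum C" "C \<subseteq> (f ^^ (m * n)) ` H \<inter> V t" "\<eta> \<le> diameter C"
      using H(1) by blast
    then show ?thesis using \<eta>(1) by (intro exI[of _ C]) auto
  qed
  then have "\<forall>t\<in>T. \<exists>A. continuum A \<and> A \<subseteq> V t \<and> 0 < diameter A" by blast
  from bchoice[OF this] obtain A where
    A: "\<forall>t\<in>T. continuum (A t) \<and> A t \<subseteq> V t \<and> 0 < diameter (A t)" ..
  have "\<forall>\<^sub>F n in sequentially. \<forall>t\<in>T. (f ^^ (m * n)) ` A t \<inter> E t \<noteq> {}"
  proof (intro eventually_ball_finite T ballI)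
    fix t assume t: "t \<in> T"
    have "A t \<subseteq> H" using A V[OF t] t openin_imp_subset by blast
    then show "\<forall>\<^sub>F n in sequentially. (f ^^ (m * n)) ` A t \<inter> E t \<noteq> {}"
      using subcontinua_spread[of "diameter (A t)" "E t"] A t E[OF t]
      by (auto elim!: eventually_mono)
  qed
  then obtain N where N: "\<forall>n\<ge>N. \<forall>t\<in>T. (f ^^ (m * n)) ` A t \<inter> E t \<noteq> {}"
    unfolding eventually_sequentially ..
  define n where "n = max N k"
  define E' where "E' t = H \<inter> (g ^^ (m * n)) -` V t \<inter> E t" for t
  have gH: "(g ^^ (m * n)) ` H \<subseteq> H" using funpow_image_H(2) by simp
  have cont: "continuous_on H (g ^^ (m * n))"
    by (rule continuous_on_subset[OF funpow_cont(2) H(2)])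
  have "openin (top_of_set H) (E' t) \<and> E' t \<noteq> {} \<and> E' t \<subseteq> E t \<and> (g ^^ (m * n)) ` E' t \<subseteq> V t"
    if t: "t \<in> T" for t
  proof (intro conjI)
    have "openin (top_of_set H) (H \<inter> (g ^^ (m * n)) -` V t)"
      using cont gH V[OF t] by (intro continuous_openin_preimage[of _ _ H]) auto
    then show "openin (top_of_set H) (E' t)"
      using E[OF t] by (auto simp: E'_def)
    have "(f ^^ (m * n)) ` A t \<inter> E t \<noteq> {}" using N t by (simp add: n_def)
    then obtain y where y: "y \<in> A t" "(f ^^ (m * n)) y \<in> E t" by blast
    have yV: "y \<in> V t" using A t y(1) by blast
    then have "y \<in> H" using V[OF t] openin_imp_subset by blast
    then have "(g ^^ (m * n)) ((f ^^ (m * n)) y) = y"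
      using funpow_cancel(1)[of y "m * n" "m * n"] H(2) by auto
    moreover have "(f ^^ (m * n)) y \<in> H" using \<open>y \<in> H\<close> funpow_image_H(1)[of n] by blast
    ultimately have "(f ^^ (m * n)) y \<in> E' t" using y(2) yV by (simp add: E'_def)
    then show "E' t \<noteq> {}" by blast
  qed (auto simp: E'_def)
  moreover have "k \<le> m * n"
  proof -
    have "1 * k \<le> m * n" using m(1) by (intro mult_le_mono) (auto simp: n_def)
    then show ?thesis by simp
  qed
  ultimately show ?thesis by blast
qed

text \<open>The target families in \<open>\<V>\<close> are treated one after another, each with its
  own time \<open>n\<close>; what was achieved for earlier ones survives because the cells only
  become smaller.\<close>

lemma shrink_open_family_finite:
  assumes T: "finite T" and \<V>: "finite \<V>"
    and E: "\<And>t. t \<in> T \<Longrightarrow> openin (top_of_set H) (E t) \<and> E t \<noteq> {}"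
    and V: "\<And>V t. V \<in> \<V> \<Longrightarrow> t \<in> T \<Longrightarrow> openin (top_of_set H) (V t) \<and> V t \<noteq> {}"
  shows "\<exists>E'. (\<forall>t\<in>T. openin (top_of_set H) (E' t) \<and> E' t \<noteq> {} \<and> E' t \<subseteq> E t) \<and>
    (\<forall>V\<in>\<V>. \<exists>n\<ge>k. \<forall>t\<in>T. (g ^^ n) ` E' t \<subseteq> V t)"
  using \<V> V
proof (induction \<V> rule: finite_induct)
  case empty
  show ?case using E by (intro exI[of _ E]) auto
next
  case (insert W \<V>)
  have "\<exists>E'. (\<forall>t\<in>T. openin (top_of_set H) (E' t) \<and> E' t \<noteq> {} \<and> E' t \<subseteq> E t) \<and>
    (\<forall>V\<in>\<V>. \<exists>n\<ge>k. \<forall>t\<in>T. (g ^^ n) ` E' t \<subseteq> V t)"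
    by (rule insert.IH) (use insert.prems in blast)
  then obtain E1 where E1: "\<forall>t\<in>T. openin (top_of_set H) (E1 t) \<and> E1 t \<noteq> {} \<and> E1 t \<subseteq> E t"
    "\<forall>V\<in>\<V>. \<exists>n\<ge>k. \<forall>t\<in>T. (g ^^ n) ` E1 t \<subseteq> V t" by blast
  have "\<exists>n\<ge>k. \<exists>E'. \<forall>t\<in>T. openin (top_of_set H) (E' t) \<and> E' t \<noteq> {} \<and> E' t \<subseteq> E1 t \<and>
    (g ^^ n) ` E' t \<subseteq> W t"
    using E1(1) insert.prems by (intro shrink_open_family T) auto
  then obtain n E2 where E2: "n \<ge> k" "\<forall>t\<in>T. openin (top_of_set H) (E2 t) \<and> E2 t \<noteq> {} \<and>
    E2 t \<subseteq> E1 t \<and> (g ^^ n) ` E2 t \<subseteq> W t" by blast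
  have "\<exists>n\<ge>k. \<forall>t\<in>T. (g ^^ n) ` E2 t \<subseteq> V t" if V: "V \<in> insert W \<V>" for V
  proof (cases "V = W")
    case True
    then show ?thesis using E2 by blast
  next
    case False
    then obtain n' where n': "n' \<ge> k" "\<forall>t\<in>T. (g ^^ n') ` E1 t \<subseteq> V t" using V E1(2) by blast
    have "(g ^^ n') ` E2 t \<subseteq> V t" if "t \<in> T" for t
      using n'(2) E2(2) that image_mono[of "E2 t" "E1 t" "g ^^ n'"] by (meson order_trans)
    then show ?thesis using n'(1) by blast
  qed
  moreover have "\<forall>t\<in>T. openin (top_of_set H) (E2 t) \<and> E2 t \<noteq> {} \<and> E2 t \<subseteq> E t"
    using E1(1) E2(2) by (meson order_trans)
  ultimately show ?case by blast
qed

text \<open>A connected nondegenerate \<open>H\<close> has no isolated points, so \<open>U\<close>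
  contains two points around which small balls can be taken.\<close>

lemma split_open:
  assumes U: "openin (top_of_set H) U" "U \<noteq> {}" and e: "e > 0"
  shows "\<exists>P :: bool \<Rightarrow> 'a set. (\<forall>b. openin (top_of_set H) (P b) \<and> P b \<noteq> {} \<and> closure (P b) \<subseteq> U \<and>
    (\<forall>x\<in>P b. \<forall>y\<in>P b. dist x y < e)) \<and> closure (P True) \<inter> closure (P False) = {}"
proof -
  obtain W where W: "open W" "U = H \<inter> W" using U(1) by (auto simp: openin_open)
  obtain p where p: "p \<in> U" using U(2) by blast
  have "p islimpt H"
    using H p W(2) by (intro connected_imp_perfect) (auto simp: continuum_def nondegenerate_def)
  then obtain q where q: "q \<in> H" "q \<in> W" "q \<noteq> p"
    using W p by (auto elim: islimptE)
  obtain r1 where r1: "r1 > 0" "ball p r1 \<subseteq> W" using W p by (meson IntD2 open_contains_ball)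
  obtain r2 where r2: "r2 > 0" "ball q r2 \<subseteq> W" using W q(2) by (meson open_contains_ball)
  \<comment> \<open>\<open>r < r1\<close> and \<open>r < r2\<close> keep the closed balls in
    \<open>W\<close>, \<open>2 * r \<le> e\<close> controls distances within a ball, and
    \<open>3 * r \<le> dist p q\<close> separates the closures.\<close>
  define r where "r = min (min (r1 / 2) (r2 / 2)) (min (e / 2) (dist p q / 3))"
  have r: "r > 0" "r < r1" "r < r2" "2 * r \<le> e" "3 * r \<le> dist p q"
    using r1(1) r2(1) e q(3) by (auto simp: r_def min_def)
  define c where "c b = (if b then p else q)" for b :: bool
  have cH: "c b \<in> H" for b using p q(1) W(2) by (auto simp: c_def)
  define P where "P b = H \<inter> ball (c b) r" for b
  have clP: "closure (P b) \<subseteq> H \<inter> cball (c b) r" for b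
    using H(1) unfolding P_def
    by (intro closure_minimal closed_Int) (auto intro: compact_imp_closed continuum_imp_compact)
  have cW: "cball (c b) r \<subseteq> W" for b
  proof -
    have "cball p r \<subseteq> ball p r1" "cball q r \<subseteq> ball q r2" using r(2,3) by auto
    then have "cball p r \<subseteq> W" "cball q r \<subseteq> W" using r1(2) r2(2) by blast+
    then show ?thesis by (simp add: c_def)
  qed
  have "openin (top_of_set H) (P b)" for b by (simp add: P_def openin_open_Int)
  moreover have "P b \<noteq> {}" for b using cH[of b] r(1) by (auto simp: P_def)
  moreover have "closure (P b) \<subseteq> U" for b using clP[of b] cW[of b] W(2) by blast
  moreover have "dist x y < e" if "x \<in> P b" "y \<in> P b" for x y b
    using that r(4) dist_triangle3[of x y "c b"] by (auto simp: P_def)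
  moreover have "closure (P True) \<inter> closure (P False) = {}"
  proof (rule ccontr)
    assume "\<not> ?thesis"
    then obtain x where "x \<in> closure (P True)" "x \<in> closure (P False)" by blast
    then have "x \<in> cball (c True) r" "x \<in> cball (c False) r"
      using clP[of True] clP[of False] by blast+
    then have "x \<in> cball p r" "x \<in> cball q r" by (simp_all add: c_def)
    then show False using r(1,5) dist_triangle2[of p q x] by (auto simp: dist_commute)
  qed
  ultimately show ?thesis by (intro exI[of _ P]) blast
qed

definition stage :: "nat \<Rightarrow> (bool list \<Rightarrow> 'a set) \<Rightarrow> bool" where
  "stage k E \<longleftrightarrow> (\<forall>s. length s = k \<longrightarrow> openin (top_of_set H) (E s) \<and> E s \<noteq> {})"

text \<open>The last clause lets every map \<open>\<phi>\<close> between cells of level \<open>k\<close> be realised by one power \<open>g ^^ n\<close>.\<close>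

definition refines :: "nat \<Rightarrow> (bool list \<Rightarrow> 'a set) \<Rightarrow> (bool list \<Rightarrow> 'a set) \<Rightarrow> bool" where
  "refines k E E' \<longleftrightarrow>
     (\<forall>s b. length s = k \<longrightarrow> closure (E' (s @ [b])) \<subseteq> E s \<and>
        (\<forall>x\<in>E' (s @ [b]). \<forall>y\<in>E' (s @ [b]). dist x y < (1 / 2) ^ k)) \<and>
     (\<forall>s. length s = k \<longrightarrow> E' (s @ [True]) \<inter> E' (s @ [False]) = {}) \<and>
     (\<forall>\<phi>. (\<forall>s. length s = k \<longrightarrow> length (\<phi> s) = k) \<longrightarrow>
        (\<exists>n\<ge>k. \<forall>s b. length s = k \<longrightarrow> (g ^^ n) ` E' (s @ [b]) \<subseteq> E (\<phi> s)))"

lemma refinesD: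
  assumes "refines k E E'" "length s = k"
  shows "closure (E' (s @ [b])) \<subseteq> E s"
    "x \<in> E' (s @ [b]) \<Longrightarrow> y \<in> E' (s @ [b]) \<Longrightarrow> dist x y < (1 / 2) ^ k"
    "E' (s @ [True]) \<inter> E' (s @ [False]) = {}"
  using assms unfolding refines_def by blast+

text \<open>Each cell is first split into two small halves with disjoint closures. There are only
  finitely many maps between words of length \<open>k\<close>, so the halves can then be shrunk
  until every such map is realised by a power of \<open>g\<close>.\<close>

lemma stage_refine:
  assumes E: "stage k E"
  shows "\<exists>E'. stage (Suc k) E' \<and> refines k E E'"
proof -
  let ?S = "{s :: bool list. length s = k}" and ?T = "{t :: bool list. length t = Suc k}"
  have finS: "finite ?S" and finT: "finite ?T"
    using finite_lists_length_eq[of "UNIV :: bool set"] by simp_all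
  have "\<forall>s\<in>?S. \<exists>P :: bool \<Rightarrow> 'a set. (\<forall>b. openin (top_of_set H) (P b) \<and> P b \<noteq> {} \<and>
    closure (P b) \<subseteq> E s \<and> (\<forall>x\<in>P b. \<forall>y\<in>P b. dist x y < (1 / 2) ^ k)) \<and>
    closure (P True) \<inter> closure (P False) = {}"
  proof
    fix s assume "s \<in> ?S"
    then have "openin (top_of_set H) (E s)" "E s \<noteq> {}" using E by (simp_all add: stage_def)
    then show "\<exists>P :: bool \<Rightarrow> 'a set. (\<forall>b. openin (top_of_set H) (P b) \<and> P b \<noteq> {} \<and>
      closure (P b) \<subseteq> E s \<and> (\<forall>x\<in>P b. \<forall>y\<in>P b. dist x y < (1 / 2) ^ k)) \<and>
      closure (P True) \<inter> closure (P False) = {}"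
      by (rule split_open) simp
  qed
  from bchoice[OF this] obtain P :: "bool list \<Rightarrow> bool \<Rightarrow> 'a set" where
    "\<forall>s\<in>?S. (\<forall>b. openin (top_of_set H) (P s b) \<and> P s b \<noteq> {} \<and>
    closure (P s b) \<subseteq> E s \<and> (\<forall>x\<in>P s b. \<forall>y\<in>P s b. dist x y < (1 / 2) ^ k)) \<and>
    closure (P s True) \<inter> closure (P s False) = {}" ..
  then have P: "openin (top_of_set H) (P s b)" "P s b \<noteq> {}" "closure (P s b) \<subseteq> E s"
    "\<And>x y. x \<in> P s b \<Longrightarrow> y \<in> P s b \<Longrightarrow> dist x y < (1 / 2) ^ k"
    "closure (P s True) \<inter> closure (P s False) = {}" if "length s = k" for s b
    using that by simp_all
  \<comment> \<open>A target family assigns to a word \<open>t\<close> of length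
    \<open>Suc k\<close> the cell chosen for its parent \<open>butlast t\<close>. Extensional
    functions are used so that the families are finite in number.\<close>
  define \<V> where "\<V> = (\<lambda>\<phi> t. E (\<phi> (butlast t))) ` (?S \<rightarrow>\<^sub>E ?S)"
  have "\<exists>E'. (\<forall>t\<in>?T. openin (top_of_set H) (E' t) \<and> E' t \<noteq> {} \<and> E' t \<subseteq> P (butlast t) (last t)) \<and>
    (\<forall>V\<in>\<V>. \<exists>n\<ge>k. \<forall>t\<in>?T. (g ^^ n) ` E' t \<subseteq> V t)"
  proof (rule shrink_open_family_finite[OF finT])
    show "finite \<V>" unfolding \<V>_def using finS by (intro finite_imageI finite_PiE) auto
    show "openin (top_of_set H) (P (butlast t) (last t)) \<and> P (butlast t) (last t) \<noteq> {}"
      if "t \<in> ?T" for t using that P(1,2)[of "butlast t"] by simp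
    show "openin (top_of_set H) (V t) \<and> V t \<noteq> {}" if V: "V \<in> \<V>" and t: "t \<in> ?T" for V t
    proof -
      obtain \<phi> where \<phi>: "\<phi> \<in> ?S \<rightarrow>\<^sub>E ?S" "V = (\<lambda>t. E (\<phi> (butlast t)))"
        using V unfolding \<V>_def by blast
      have "butlast t \<in> ?S" using t by simp
      then have "\<phi> (butlast t) \<in> ?S" using \<phi>(1) by (rule PiE_mem[rotated])
      then show ?thesis using E by (simp add: \<phi>(2) stage_def)
    qed
  qed
  then obtain E' where E': "\<forall>t\<in>?T. openin (top_of_set H) (E' t) \<and> E' t \<noteq> {} \<and> E' t \<subseteq> P (butlast t) (last t)"
    "\<forall>V\<in>\<V>. \<exists>n\<ge>k. \<forall>t\<in>?T. (g ^^ n) ` E' t \<subseteq> V t" by (elim exE conjE)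
  have sub: "E' (s @ [b]) \<subseteq> P s b" if "length s = k" for s b
    using E'(1)[rule_format, of "s @ [b]"] that by simp
  have "stage (Suc k) E'" using E'(1) by (simp add: stage_def)
  moreover have "refines k E E'"
    unfolding refines_def
  proof (intro conjI allI impI ballI)
    fix s :: "bool list" and b assume s: "length s = k"
    show "closure (E' (s @ [b])) \<subseteq> E s"
      using closure_mono[OF sub[OF s]] P(3)[OF s] by (rule order_trans)
    show "dist x y < (1 / 2) ^ k" if "x \<in> E' (s @ [b])" "y \<in> E' (s @ [b])" for x y
      using P(4)[OF s] sub[OF s] that by blast
  next
    fix s :: "bool list" assume s: "length s = k"
    have "E' (s @ [True]) \<subseteq> closure (P s True)" "E' (s @ [False]) \<subseteq> closure (P s False)"
      using sub[OF s] closure_subset order_trans by blast+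
    then show "E' (s @ [True]) \<inter> E' (s @ [False]) = {}" using P(5)[OF s] by blast
  next
    fix \<phi> :: "bool list \<Rightarrow> bool list" assume \<phi>: "\<forall>s. length s = k \<longrightarrow> length (\<phi> s) = k"
    \<comment> \<open>An arbitrary \<open>\<phi>\<close> is represented by its restriction to words
      of length \<open>k\<close>, the only words at which it is evaluated.\<close>
    have "restrict \<phi> ?S \<in> ?S \<rightarrow>\<^sub>E ?S" using \<phi> by (simp add: restrict_PiE_iff)
    then have "(\<lambda>t. E (restrict \<phi> ?S (butlast t))) \<in> \<V>" unfolding \<V>_def by (rule imageI)
    from E'(2)[rule_format, OF this]
    obtain n where n: "n \<ge> k" "\<forall>t\<in>?T. (g ^^ n) ` E' t \<subseteq> E (restrict \<phi> ?S (butlast t))"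
      by (elim exE conjE)
    have "(g ^^ n) ` E' (s @ [b]) \<subseteq> E (\<phi> s)" if "length s = k" for s b
      using n(2)[rule_format, of "s @ [b]"] that by simp
    then show "\<exists>n\<ge>k. \<forall>s b. length s = k \<longrightarrow> (g ^^ n) ` E' (s @ [b]) \<subseteq> E (\<phi> s)" using n(1) by blast
  qed
  ultimately show ?thesis by blast
qed

text \<open>Iterating \<open>stage_refine\<close> gives nested cells along every binary sequence.
  Their compact closures have a common point, which lies in the cells themselves because the closure
  of each is contained in its predecessor.\<close>

lemma cantor_scheme:
  obtains \<zeta> :: "(nat \<Rightarrow> bool) \<Rightarrow> 'a" and E :: "nat \<Rightarrow> bool list \<Rightarrow> 'a set" where
    "inj \<zeta>" "continuous_on UNIV \<zeta>" "range \<zeta> \<subseteq> H"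
    "\<And>k. refines k (E k) (E (Suc k))" "\<And>\<alpha> k. \<zeta> \<alpha> \<in> E k (code \<alpha> k)"
proof -
  have "stage 0 (\<lambda>_. H)" using continuum_imp_nonempty[OF H(1)] by (simp add: stage_def)
  then have "\<exists>E. stage 0 E" by blast
  from dependent_nat_choice[of stage refines, OF this stage_refine]
  obtain E where E: "\<forall>k. stage k (E k) \<and> refines k (E k) (E (Suc k))" ..
  have cl: "closure (E (Suc k) (code \<alpha> (Suc k))) \<subseteq> E k (code \<alpha> k)" for k \<alpha>
    using refinesD(1)[of k "E k" "E (Suc k)" "code \<alpha> k"] E by (simp add: code_Suc)
  have "openin (top_of_set H) (E k (code \<alpha> k))" and Ene: "E k (code \<alpha> k) \<noteq> {}" for k \<alpha>
    using E by (simp_all add: stage_def)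
  then have EH: "E k (code \<alpha> k) \<subseteq> H" for k \<alpha>
    by (blast dest: openin_imp_subset)
  have small: "dist x y < (1 / 2) ^ k" if "x \<in> E (Suc k) (code \<alpha> (Suc k))" "y \<in> E (Suc k) (code \<alpha> (Suc k))"
    for x y k \<alpha>
    using refinesD(2)[of k "E k" "E (Suc k)" "code \<alpha> k" x "\<alpha> k" y] E that by (simp add: code_Suc)
  have "\<exists>x. \<forall>k. x \<in> E k (code \<alpha> k)" for \<alpha>
  proof -
    define F where "F k = closure (E k (code \<alpha> k))" for k
    have dec: "F (Suc k) \<subseteq> F k" for k
      unfolding F_def by (rule order_trans[OF cl closure_subset])
    have mono: "F j \<subseteq> F i" if "i \<le> j" for i j
      using that by (rule lift_Suc_antimono_le[rotated]) (rule dec)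
    have cF: "compact (F k)" for k
    proof -
      have "F k \<subseteq> H" unfolding F_def
        by (intro closure_minimal EH compact_imp_closed continuum_imp_compact H)
      then show ?thesis
        using compact_Int_closed[OF continuum_imp_compact[OF H(1)], of "F k"]
        by (simp add: F_def Int_absorb1)
    qed
    have "\<Inter>(range F) \<noteq> {}"
    proof
      assume "\<Inter>(range F) = {}"
      then have "\<exists>S\<in>range F. S \<subseteq> {}"
        by (intro compact_chain_subset_open) (use cF mono nat_le_linear in blast)+
      then obtain k where "F k = {}" by blast
      then show False using Ene by (simp add: F_def)
    qed
    then obtain x where "\<And>k. x \<in> F k" by auto
    then have "x \<in> E k (code \<alpha> k)" for k using cl[of k \<alpha>] unfolding F_def by blast
    then show ?thesis by blast
  qed
  then obtain \<zeta> where \<zeta>: "\<And>\<alpha> k. \<zeta> \<alpha> \<in> E k (code \<alpha> k)" by metis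
  have "inj \<zeta>"
  proof (rule injI, rule ccontr)
    fix \<alpha> \<beta> :: "nat \<Rightarrow> bool" assume eq: "\<zeta> \<alpha> = \<zeta> \<beta>" and "\<alpha> \<noteq> \<beta>"
    \<comment> \<open>At the first index of difference the two addresses extend a common word by
      different letters, and sibling cells are disjoint.\<close>
    define k where "k = (LEAST i. \<alpha> i \<noteq> \<beta> i)"
    have k: "\<alpha> k \<noteq> \<beta> k" "\<forall>i<k. \<alpha> i = \<beta> i"
      using \<open>\<alpha> \<noteq> \<beta>\<close> LeastI_ex[of "\<lambda>i. \<alpha> i \<noteq> \<beta> i"] not_less_Least[of _ "\<lambda>i. \<alpha> i \<noteq> \<beta> i"]
      unfolding k_def by (blast, blast)
    have "code \<alpha> k = code \<beta> k" using k(2) by (simp add: code_eq_iff)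
    then have "\<zeta> \<alpha> \<in> E (Suc k) (code \<alpha> k @ [\<alpha> k])" "\<zeta> \<alpha> \<in> E (Suc k) (code \<alpha> k @ [\<beta> k])"
      using \<zeta>[of \<alpha> "Suc k"] \<zeta>[of \<beta> "Suc k"] eq by (simp_all add: code_Suc)
    moreover have "E (Suc k) (code \<alpha> k @ [True]) \<inter> E (Suc k) (code \<alpha> k @ [False]) = {}"
      using refinesD(3)[of k "E k" "E (Suc k)"] E by simp
    ultimately show False using k(1) by (cases "\<alpha> k"; cases "\<beta> k") auto
  qed
  moreover have "continuous_on UNIV \<zeta>"
    unfolding continuous_on_def
  proof
    fix \<alpha> :: "nat \<Rightarrow> bool"
    show "(\<zeta> \<longlongrightarrow> \<zeta> \<alpha>) (at \<alpha>)"
      unfolding tendsto_iff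
    proof (intro allI impI)
      fix e :: real assume "e > 0"
      then obtain k where k: "(1 / 2) ^ k < e" using real_arch_pow_inv[of e "1 / 2"] by auto
      have "dist (\<zeta> \<beta>) (\<zeta> \<alpha>) < e" if "\<beta> \<in> {\<beta>. \<forall>i<Suc k. \<beta> i = \<alpha> i}" for \<beta>
      proof -
        have "code \<beta> (Suc k) = code \<alpha> (Suc k)" using that by (simp add: code_eq_iff)
        then have "dist (\<zeta> \<beta>) (\<zeta> \<alpha>) < (1 / 2) ^ k"
          using small[of "\<zeta> \<beta>" k \<alpha> "\<zeta> \<alpha>"] \<zeta>[of \<beta> "Suc k"] \<zeta>[of \<alpha> "Suc k"] by simp
        then show ?thesis using k by simp
      qed
      then show "\<forall>\<^sub>F \<beta> in at \<alpha>. dist (\<zeta> \<beta>) (\<zeta> \<alpha>) < e"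
        unfolding eventually_at_topological
        using open_agree_upto[of "Suc k" \<alpha>] by (intro exI[of _ "{\<beta>. \<forall>i<Suc k. \<beta> i = \<alpha> i}"]) auto
    qed
  qed
  moreover have "range \<zeta> \<subseteq> H" using \<zeta>[of _ 0] EH[of 0] by blast
  ultimately show thesis using that[of \<zeta> E] E \<zeta> by blast
qed

text \<open>At a level where the addresses of the points \<open>y i\<close> are distinct, some map
  of words sends each of them to the address of \<open>z i\<close>. The power of \<open>g\<close>
  realising it moves every \<open>y i\<close> into the cell of \<open>z i\<close>, which is small.
  The points \<open>z i\<close> may coincide.\<close>

theorem independent_Cantor_set:
  "\<exists>Z\<subseteq>H. Cantor_set Z \<and> (\<forall>(I::'i set) y z e N. finite I \<and> inj_on y I \<and> y ` I \<subseteq> Z \<and> z ` I \<subseteq> Z \<and> e > 0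
     \<longrightarrow> (\<exists>n\<ge>N. \<forall>i\<in>I. dist ((g ^^ n) (y i)) (z i) < e))"
proof -
  obtain \<zeta> :: "(nat \<Rightarrow> bool) \<Rightarrow> 'a" and E :: "nat \<Rightarrow> bool list \<Rightarrow> 'a set" where
    \<zeta>: "inj \<zeta>" "continuous_on UNIV \<zeta>" "range \<zeta> \<subseteq> H"
    and E: "\<And>k. refines k (E k) (E (Suc k))" and \<zeta>E: "\<And>\<alpha> k. \<zeta> \<alpha> \<in> E k (code \<alpha> k)"
    using cantor_scheme by metis
  have "Cantor_set (range \<zeta>)"
    unfolding Cantor_set_def
    using homeomorphic_compact[OF compact_UNIV_nat_bool \<zeta>(2) refl \<zeta>(1)] homeomorphic_sym by blast
  moreover have "\<exists>n\<ge>N. \<forall>i\<in>I. dist ((g ^^ n) (y i)) (z i) < e"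
    if I: "finite I" "inj_on y I" and yz: "y ` I \<subseteq> range \<zeta>" "z ` I \<subseteq> range \<zeta>" and e: "e > 0"
    for I :: "'i set" and y z e N
  proof -
    have "\<forall>i\<in>I. \<exists>\<alpha>. y i = \<zeta> \<alpha>" "\<forall>i\<in>I. \<exists>\<alpha>. z i = \<zeta> \<alpha>" using yz by blast+
    then obtain a b where a: "\<forall>i\<in>I. y i = \<zeta> (a i)" and b: "\<forall>i\<in>I. z i = \<zeta> (b i)"
      using bchoice by metis
    have dif: "\<forall>\<^sub>F k in sequentially. code (a i) k \<noteq> code (a j) k" if ij: "i \<in> I" "j \<in> I" "i \<noteq> j" for i j
    proof -
      have "a i \<noteq> a j" using I(2) a ij by (metis inj_onD)
      then obtain p where p: "a i p \<noteq> a j p" by blast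
      show ?thesis unfolding eventually_sequentially
      proof (intro exI[of _ "Suc p"] allI impI)
        fix k assume "Suc p \<le> k"
        then have "p < k" by simp
        then show "code (a i) k \<noteq> code (a j) k" using p unfolding code_eq_iff by blast
      qed
    qed
    have "\<forall>\<^sub>F k in sequentially. \<forall>i\<in>I. \<forall>j\<in>I. i \<noteq> j \<longrightarrow> code (a i) k \<noteq> code (a j) k"
      using dif by (intro eventually_ball_finite I ballI) (auto simp: eventually_mono)
    then obtain K0 where K0: "\<forall>k\<ge>K0. \<forall>i\<in>I. \<forall>j\<in>I. i \<noteq> j \<longrightarrow> code (a i) k \<noteq> code (a j) k"
      unfolding eventually_sequentially ..
    obtain K1 where K1: "(1 / 2) ^ K1 < e" using real_arch_pow_inv[OF e, of "1 / 2"] by auto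
    \<comment> \<open>The argument runs at level \<open>Suc K\<close>, because points of one cell of
      that level are less than \<open>(1 / 2) ^ K\<close> apart.\<close>
    define K where "K = max N (max K0 K1)"
    have K: "N \<le> Suc K" "K0 \<le> Suc K" by (simp_all add: K_def)
    have "(1 / 2) ^ K \<le> (1 / 2 :: real) ^ K1" by (intro power_decreasing) (simp_all add: K_def)
    then have Ke: "(1 / 2) ^ K < e" using K1 by (rule order.strict_trans1)
    define c where "c i = code (a i) (Suc K)" for i
    have inj: "inj_on c I" using K0 K(2) by (auto simp: inj_on_def c_def)
    \<comment> \<open>The identity is a length-preserving default outside the addresses in question.
      Injectivity of \<open>c\<close> ensures that \<open>c i\<close> is sent to the address of
      \<open>z i\<close>.\<close>
    define \<phi> where "\<phi> s = (if s \<in> c ` I then code (b (inv_into I c s)) (Suc K) else s)" for s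
    have \<phi>c: "\<phi> (c i) = code (b i) (Suc K)" if "i \<in> I" for i
      using that inj by (simp add: \<phi>_def inv_into_f_f)
    have "\<forall>s. length s = Suc K \<longrightarrow> length (\<phi> s) = Suc K" by (simp add: \<phi>_def)
    then obtain n where n: "n \<ge> Suc K"
      "\<forall>s d. length s = Suc K \<longrightarrow> (g ^^ n) ` E (Suc (Suc K)) (s @ [d]) \<subseteq> E (Suc K) (\<phi> s)"
      using E[of "Suc K"] unfolding refines_def by blast
    have "dist ((g ^^ n) (y i)) (z i) < e" if i: "i \<in> I" for i
    proof -
      have "y i \<in> E (Suc (Suc K)) (c i @ [a i (Suc K)])"
        using \<zeta>E[of "a i" "Suc (Suc K)"] a i by (simp add: c_def code_Suc[of _ "Suc K"])
      moreover have "length (c i) = Suc K" by (simp add: c_def)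
      ultimately have "(g ^^ n) (y i) \<in> E (Suc K) (\<phi> (c i))" using n(2) by blast
      then have 1: "(g ^^ n) (y i) \<in> E (Suc K) (code (b i) K @ [b i K])"
        using \<phi>c[OF i] by (simp add: code_Suc)
      have 2: "z i \<in> E (Suc K) (code (b i) K @ [b i K])"
        using \<zeta>E[of "b i" "Suc K"] b i by (simp add: code_Suc)
      have "dist ((g ^^ n) (y i)) (z i) < (1 / 2) ^ K"
        by (rule refinesD(2)[OF E length_code 1 2])
      then show ?thesis using Ke by simp
    qed
    then show ?thesis using order_trans[OF K(1) n(1)] by (intro exI[of _ n]) simp
  qed
  ultimately show ?thesis using \<zeta>(3) by (intro exI[of _ "range \<zeta>"] conjI allI impI) simp_all
qed

end

section \<open>Assembly: composants, vertical embedding and the liminf condition\<close>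

theorem corollary4p3:
  fixes X H :: "'a::metric_space set" and f g :: "'a \<Rightarrow> 'a"
  assumes "continuum X"
    and "homeomorphism X X f g"
    and "pos_cw_expansive X f"
    and "u_chaotic_continuum X g H"
    and "\<exists>n\<ge>1. (f ^^ n) ` H = H"
    and "indecomposable_continuum H"
    and "{composant H p | p. p \<in> H} = {Vu g H x | x. x \<in> H}"
  shows "\<exists>Z. Z \<subseteq> H \<and> Cantor_set Z \<and> vertically_embedded Z H \<and>
    (\<forall>p\<in>H. \<forall>x\<in>composant H p. \<forall>y\<in>composant H p.
       (\<lambda>n. dist ((g ^^ n) x) ((g ^^ n) y)) \<longlonglongrightarrow> 0) \<and>
    (\<forall>xs. xs \<noteq> [] \<and> set xs \<subseteq> Z \<longrightarrow> IE_tuple X g xs) \<and>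
    (\<forall>k\<ge>1. \<forall>y z :: nat \<Rightarrow> 'a.
       inj_on y {1..k} \<and> y ` {1..k} \<subseteq> Z \<and> z ` {1..k} \<subseteq> Z \<longrightarrow>
       liminf (\<lambda>n. ereal (Max ((\<lambda>i. dist ((g ^^ n) (y i)) (z i)) ` {1..k}))) = 0)"
proof -
  have X: "compact X" using assms(1) by (rule continuum_imp_compact)
  obtain \<delta> where \<delta>: "\<delta> > 0"
    "\<And>\<gamma>. \<gamma> > 0 \<Longrightarrow> \<exists>N. \<forall>A n. continuum A \<and> A \<subseteq> X \<and> \<gamma> \<le> diameter A \<and> N \<le> n \<longrightarrow>
       \<delta> \<le> diameter ((f ^^ n) ` A)"
    by (rule pos_cw_expansive_uniform[OF X assms(2,3)], rule that)
  interpret expanding_homeo X f g \<delta>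
    using X assms(2) \<delta> by unfold_locales
  have H: "continuum H" "H \<subseteq> X" "nondegenerate H"
    using assms(4,6) by (simp_all add: indecomposable_continuum_def u_chaotic_continuum_def)
  obtain m where m: "m \<ge> 1" "(f ^^ m) ` H = H" using assms(5) by blast
  \<comment> \<open>The equality of the two families is used in this form; the point
    \<open>q\<close> is a priori different from \<open>p\<close>.\<close>
  have leaf: "\<exists>q\<in>H. composant H p = Vu g H q" if "p \<in> H" for p
  proof -
    have "composant H p \<in> {Vu g H x | x. x \<in> H}"
      using that by (subst assms(7)[symmetric]) blast
    then show ?thesis by blast
  qed
  \<comment> \<open>A proper subcontinuum lies in the composant of any of its points, hence in some
    \<open>Vu g H q\<close>, and the Baire argument makes it shrink. This discharges
    \<open>proper_shrinks\<close>.\<close>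
  interpret mixing_subcontinuum X f g \<delta> H m
  proof unfold_locales
    fix B assume B: "continuum B" "B \<subset> H"
    obtain p where p: "p \<in> B" using continuum_imp_nonempty[OF B(1)] by blast
    then obtain q where "composant H p = Vu g H q" using leaf[of p] B(2) by blast
    moreover have "B \<subseteq> composant H p" using B p by (auto simp: composant_def)
    ultimately show "shrinks B"
      using subset_Vu_shrinks[OF B(1) _ continuum_imp_compact[OF H(1)] H(2)] by simp
  qed (use H m in auto)
  have toward: "(\<lambda>n. dist ((g ^^ n) q) ((g ^^ n) x)) \<longlonglongrightarrow> 0" if x: "x \<in> Vu g H q" for q x
  proof -
    obtain A where A: "A \<in> hyperspace_C H" "q \<in> A" "x \<in> A"
      "(\<lambda>n. diameter ((g ^^ n) ` A)) \<longlonglongrightarrow> 0" using x by (auto simp: Vu_def)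
    then have "compact A" "A \<subseteq> X"
      using closedin_compact[OF continuum_imp_compact[OF H(1)]] closedin_imp_subset[of euclidean H A]
        H(2) by (auto simp: hyperspace_C_def)
    then have "compact ((g ^^ n) ` A)" for n
      by (intro compact_continuous_image continuous_on_subset[OF funpow_cont(2)])
    then have "dist ((g ^^ n) q) ((g ^^ n) x) \<le> diameter ((g ^^ n) ` A)" for n
      using A(2,3) by (intro dist_le_diameter_compact) auto
    then show ?thesis
      by (intro tendsto_sandwich[OF _ _ tendsto_const A(4)] always_eventually) auto
  qed
  have asymptotic: "(\<lambda>n. dist ((g ^^ n) x) ((g ^^ n) y)) \<longlonglongrightarrow> 0"
    if p: "p \<in> H" and xy: "x \<in> composant H p" "y \<in> composant H p" for p x y
  proof -
    obtain q where q: "composant H p = Vu g H q" using leaf[OF p] by blast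
    have "(\<lambda>n. dist ((g ^^ n) q) ((g ^^ n) x) + dist ((g ^^ n) q) ((g ^^ n) y)) \<longlonglongrightarrow> 0 + 0"
      using xy q by (intro tendsto_add toward) auto
    then have sum0: "(\<lambda>n. dist ((g ^^ n) q) ((g ^^ n) x) + dist ((g ^^ n) q) ((g ^^ n) y)) \<longlonglongrightarrow> 0"
      by simp
    show ?thesis
      by (rule tendsto_sandwich[OF _ _ tendsto_const sum0])
        (simp_all add: dist_triangle3 always_eventually)
  qed
  obtain Z where Z: "Z \<subseteq> H" "Cantor_set Z" and steer:
    "\<forall>(I::nat set) y z e N. finite I \<and> inj_on y I \<and> y ` I \<subseteq> Z \<and> z ` I \<subseteq> Z \<and> e > 0
     \<longrightarrow> (\<exists>n\<ge>N. \<forall>i\<in>I. dist ((g ^^ n) (y i)) (z i) < e)"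
    using independent_Cantor_set by (elim exE conjE)
  \<comment> \<open>Two points of one composant are asymptotic, yet \<open>x\<close> and
    \<open>y\<close> can both be steered back to within \<open>e\<close> of themselves at one late
    time \<open>n\<close>. This gives \<open>dist x y < 3 * e\<close>, contrary to the choice of
    \<open>e\<close>.\<close>
  have "vertically_embedded Z H"
    unfolding vertically_embedded_def
  proof (intro conjI ballI impI Z notI, elim bexE conjE)
    fix x y p
    assume xy: "x \<in> Z" "y \<in> Z" "x \<noteq> y" and p: "p \<in> H" "x \<in> composant H p" "y \<in> composant H p"
    define e where "e = dist x y / 3"
    have e: "e > 0" using xy(3) by (simp add: e_def)
    obtain N where N: "\<And>n. n \<ge> N \<Longrightarrow> dist ((g ^^ n) x) ((g ^^ n) y) < e"
      using order_tendstoD(2)[OF asymptotic[OF p] e] by (auto simp: eventually_sequentially)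
    \<comment> \<open>The pair, indexed by \<open>{0, 1}\<close>, is both the source and the target
      of the steering.\<close>
    define w where "w i = (if i = (0::nat) then x else y)" for i
    have "inj_on w {0, 1}" "w ` {0, 1} \<subseteq> Z" using xy by (auto simp: inj_on_def w_def)
    then obtain n where n: "n \<ge> N" "\<forall>i\<in>{0, 1}. dist ((g ^^ n) (w i)) (w i) < e"
      using steer[rule_format, of "{0, 1}" w w e N] e by auto
    then have "dist ((g ^^ n) x) x < e" "dist ((g ^^ n) y) y < e" by (simp_all add: w_def)
    then have "dist x y < 3 * e"
      using N[OF n(1)] dist_triangle3[of x y "(g ^^ n) x"] dist_triangle[of "(g ^^ n) x" y "(g ^^ n) y"]
      by linarith
    then show False by (simp add: e_def)
  qed
  moreover have "liminf (\<lambda>n. ereal (Max ((\<lambda>i. dist ((g ^^ n) (y i)) (z i)) ` {1..k}))) = 0"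
    if k: "k \<ge> 1" and yz: "inj_on y {1..k}" "y ` {1..k} \<subseteq> Z" "z ` {1..k} \<subseteq> Z"
    for k :: nat and y z :: "nat \<Rightarrow> 'a"
  proof (rule liminf_eq_0I)
    show "0 \<le> Max ((\<lambda>i. dist ((g ^^ n) (y i)) (z i)) ` {1..k})" for n
      using k by (subst Max_ge_iff) auto
    fix e :: real and N assume "e > 0"
    then obtain n where "n \<ge> N" "\<forall>i\<in>{1..k}. dist ((g ^^ n) (y i)) (z i) < e"
      using steer[rule_format, of "{1..k}" y z e N] yz by auto
    then show "\<exists>n\<ge>N. Max ((\<lambda>i. dist ((g ^^ n) (y i)) (z i)) ` {1..k}) < e"
      using k by (intro exI[of _ n]) auto
  qed
  moreover have "IE_tuple X g xs" if "xs \<noteq> []" "set xs \<subseteq> Z" for xs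
    using IE_tuple_in_H that Z(1) by blast
  ultimately show ?thesis
    using Z asymptotic by (intro exI[of _ Z] conjI allI ballI impI; (elim conjE)?) blast+
qed

end
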